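(* Let $G$ be a topological group and let $p\colon E\to B$ be a $G$-map. If there are cohomology classes $u_1,\dots,u_k\in\widetilde{H}^{*}_{G}(B;R)$ (for any commutative ring $R$) with $$(p^h_G)^*(u_1)=\cdots=(p^h_G)^*(u_k)=0\quad\text{and}\quad u_1\smile\cdots\smile u_k\ne 0,$$ then $\mathrm{secat}_G(p)>k$.
   Context: All spaces are Hausdorff. A $G$-map is a continuous equivariant map; a $G$-homotopy is an equivariant homotopy ($G$ acting trivially on $[0,1]$). Borel cohomology: for a universal principal $G$-bundle $EG\to BG$ and a $G$-space $X$, $X^h_G=EG\times_G X$ is the homotopy orbit space, the quotient of $EG\times X$ by $(eg,x)\sim(e,gx)$ for $e\in EG$, $g\in G$, $x\in X$; $H^*_G(X;R)=H^*(X^h_G;R)$, and $\widetilde{H}^*_G(X;R)=\widetilde{H}^*(X^h_G;R)$ is its reduced version. A $G$-map $p\colon E\to B$ induces $p^h_G\colon E^h_G\to B^h_G$. Equivariant sectional category: for a $G$-map $p\colon E\to B$, $\mathrm{secat}_G(p)$ is the least positive integer $k$ such that $B$ has a cover by $G$-invariant open sets $U_1,\dots,U_k$ with $G$-maps $s_i\colon U_i\to E$ such that $p\circ s_i$ is $G$-homotopic to the inclusion $U_i\hookrightarrow B$ ($\infty$ if there is no such $k$). *)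

theory Defs
  imports "HOL-Homology.Homology" "HOL-Library.Extended_Nat"
begin

section \<open>Spaces with a group action\<close>

text \<open>
  Topological groups are types of class \<^class>\<open>topological_group_add\<close>. The class does not assume
  commutativity: \<open>g + h\<close>, \<open>0\<close>, \<open>- g\<close> are the product, the neutral element and the inverse of an
  arbitrary topological group. Spaces are values of type \<open>'a topology\<close>.
\<close>

definition left_G_space :: "'a topology \<Rightarrow> ('g::topological_group_add \<Rightarrow> 'a \<Rightarrow> 'a) \<Rightarrow> bool" where
  "left_G_space X \<alpha> \<longleftrightarrow>
     continuous_map (prod_topology euclidean X) X (\<lambda>(g, x). \<alpha> g x) \<and>
     (\<forall>x\<in>topspace X. \<alpha> 0 x = x) \<and>
     (\<forall>g h. \<forall>x\<in>topspace X. \<alpha> (g + h) x = \<alpha> g (\<alpha> h x))"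

definition right_G_space :: "'a topology \<Rightarrow> ('a \<Rightarrow> 'g::topological_group_add \<Rightarrow> 'a) \<Rightarrow> bool" where
  "right_G_space X \<rho> \<longleftrightarrow>
     continuous_map (prod_topology X euclidean) X (\<lambda>(x, g). \<rho> x g) \<and>
     (\<forall>x\<in>topspace X. \<rho> x 0 = x) \<and>
     (\<forall>g h. \<forall>x\<in>topspace X. \<rho> x (g + h) = \<rho> (\<rho> x g) h)"

definition equivariant_on :: "'a set \<Rightarrow> ('g \<Rightarrow> 'a \<Rightarrow> 'a) \<Rightarrow> ('g \<Rightarrow> 'b \<Rightarrow> 'b) \<Rightarrow> ('a \<Rightarrow> 'b) \<Rightarrow> bool" where
  "equivariant_on S \<alpha> \<beta> f \<longleftrightarrow> (\<forall>g. \<forall>x\<in>S. f (\<alpha> g x) = \<beta> g (f x))"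

definition G_map ::
    "'a topology \<Rightarrow> ('g \<Rightarrow> 'a \<Rightarrow> 'a) \<Rightarrow> 'b topology \<Rightarrow> ('g \<Rightarrow> 'b \<Rightarrow> 'b) \<Rightarrow> ('a \<Rightarrow> 'b) \<Rightarrow> bool" where
  "G_map X \<alpha> Y \<beta> f \<longleftrightarrow> continuous_map X Y f \<and> equivariant_on (topspace X) \<alpha> \<beta> f"

text \<open>As \<open>G\<close> acts trivially on the interval, a homotopy is equivariant iff each of its stages is.\<close>

definition G_homotopic ::
    "'a topology \<Rightarrow> ('g \<Rightarrow> 'a \<Rightarrow> 'a) \<Rightarrow> 'b topology \<Rightarrow> ('g \<Rightarrow> 'b \<Rightarrow> 'b) \<Rightarrow>
     ('a \<Rightarrow> 'b) \<Rightarrow> ('a \<Rightarrow> 'b) \<Rightarrow> bool" where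
  "G_homotopic X \<alpha> Y \<beta> f f' \<longleftrightarrow> homotopic_with (equivariant_on (topspace X) \<alpha> \<beta>) X Y f f'"

section \<open>Equivariant sectional category\<close>

definition secat_cover ::
    "'e topology \<Rightarrow> ('g \<Rightarrow> 'e \<Rightarrow> 'e) \<Rightarrow> 'b topology \<Rightarrow> ('g \<Rightarrow> 'b \<Rightarrow> 'b) \<Rightarrow> ('e \<Rightarrow> 'b) \<Rightarrow> nat \<Rightarrow> bool" where
  "secat_cover E \<epsilon> B \<beta> p k \<longleftrightarrow>
     (\<exists>U. (\<Union>i\<in>{1..k}. U i) = topspace B \<and>
        (\<forall>i\<in>{1..k}.
           openin B (U i) \<and> (\<forall>g. \<forall>x\<in>U i. \<beta> g x \<in> U i) \<and>
           (\<exists>s. G_map (subtopology B (U i)) \<beta> E \<epsilon> s \<and>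
                G_homotopic (subtopology B (U i)) \<beta> B \<beta> (p \<circ> s) (\<lambda>x. x))))"

text \<open>In \<^typ>\<open>enat\<close> the infimum of the empty set is \<open>\<infinity>\<close>.\<close>

definition secat ::
    "'e topology \<Rightarrow> ('g \<Rightarrow> 'e \<Rightarrow> 'e) \<Rightarrow> 'b topology \<Rightarrow> ('g \<Rightarrow> 'b \<Rightarrow> 'b) \<Rightarrow> ('e \<Rightarrow> 'b) \<Rightarrow> enat" where
  "secat E \<epsilon> B \<beta> p = Inf {enat k |k. 1 \<le> k \<and> secat_cover E \<epsilon> B \<beta> p k}"

section \<open>Universal principal bundles and homotopy orbit spaces\<close>

definition principal_bundle ::
    "'p topology \<Rightarrow> ('p \<Rightarrow> 'g::topological_group_add \<Rightarrow> 'p) \<Rightarrow> 'q topology \<Rightarrow> ('p \<Rightarrow> 'q) \<Rightarrow> bool" where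
  "principal_bundle P \<rho> Q \<pi> \<longleftrightarrow>
     right_G_space P \<rho> \<and> continuous_map P Q \<pi> \<and>
     (\<forall>b\<in>topspace Q. \<exists>U \<phi>.
        openin Q U \<and> b \<in> U \<and>
        homeomorphic_map (prod_topology (subtopology Q U) euclidean)
          (subtopology P {e \<in> topspace P. \<pi> e \<in> U}) \<phi> \<and>
        (\<forall>u\<in>U. \<forall>g. \<pi> (\<phi> (u, g)) = u \<and> (\<forall>h. \<rho> (\<phi> (u, g)) h = \<phi> (u, g + h))))"

definition weakly_contractible :: "'a topology \<Rightarrow> bool" where
  "weakly_contractible X \<longleftrightarrow>
     topspace X \<noteq> {} \<and>
     (\<forall>n f. continuous_map (nsphere n) X f \<longrightarrow>
        (\<exists>c\<in>topspace X. homotopic_with (\<lambda>_. True) (nsphere n) X f (\<lambda>_. c)))"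

text \<open>
  Universality is expressed by weak contractibility of the total space. Bundles that are universal
  in the stricter sense (numerable, with contractible total space), such as Milnor's infinite
  join, are included.
\<close>

definition universal_principal_bundle ::
    "'p topology \<Rightarrow> ('p \<Rightarrow> 'g::topological_group_add \<Rightarrow> 'p) \<Rightarrow> 'q topology \<Rightarrow> ('p \<Rightarrow> 'q) \<Rightarrow> bool" where
  "universal_principal_bundle P \<rho> Q \<pi> \<longleftrightarrow> principal_bundle P \<rho> Q \<pi> \<and> weakly_contractible P"

definition quotient_topology :: "'a topology \<Rightarrow> ('a \<times> 'a) set \<Rightarrow> 'a set topology" where
  "quotient_topology X r =
     topology (\<lambda>U. U \<subseteq> topspace X // r \<and> openin X {x \<in> topspace X. r `` {x} \<in> U})"

lemma openin_quotient_topology: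
  "openin (quotient_topology X r) U \<longleftrightarrow>
     U \<subseteq> topspace X // r \<and> openin X {x \<in> topspace X. r `` {x} \<in> U}"
proof -
  have "istopology (\<lambda>U. U \<subseteq> topspace X // r \<and> openin X {x \<in> topspace X. r `` {x} \<in> U})"
    unfolding istopology_def
  proof (intro conjI allI impI)
    fix S T
    assume S: "S \<subseteq> topspace X // r \<and> openin X {x \<in> topspace X. r `` {x} \<in> S}"
      and T: "T \<subseteq> topspace X // r \<and> openin X {x \<in> topspace X. r `` {x} \<in> T}"
    then show "S \<inter> T \<subseteq> topspace X // r" by blast
    have eq: "{x \<in> topspace X. r `` {x} \<in> S \<inter> T} =
        {x \<in> topspace X. r `` {x} \<in> S} \<inter> {x \<in> topspace X. r `` {x} \<in> T}" by blast
    show "openin X {x \<in> topspace X. r `` {x} \<in> S \<inter> T}"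
      unfolding eq using S T by (intro openin_Int) simp_all
  next
    fix K
    assume K: "\<forall>S\<in>K. S \<subseteq> topspace X // r \<and> openin X {x \<in> topspace X. r `` {x} \<in> S}"
    then show "\<Union> K \<subseteq> topspace X // r" by blast
    have eq: "{x \<in> topspace X. r `` {x} \<in> \<Union> K} = (\<Union>S\<in>K. {x \<in> topspace X. r `` {x} \<in> S})" by blast
    show "openin X {x \<in> topspace X. r `` {x} \<in> \<Union> K}"
      unfolding eq using K by (intro openin_Union) blast
  qed
  then show ?thesis by (simp add: quotient_topology_def)
qed

lemma topspace_quotient_topology: "topspace (quotient_topology X r) = topspace X // r"
proof -
  have "{x \<in> topspace X. r `` {x} \<in> topspace X // r} = topspace X" by (auto intro: quotientI)
  then have "openin (quotient_topology X r) (topspace X // r)"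
    by (simp add: openin_quotient_topology)
  then show ?thesis
    by (meson openin_quotient_topology openin_subset openin_topspace subset_antisym)
qed

lemma quotient_map_quotient_topology:
  "quotient_map X (quotient_topology X r) (\<lambda>x. r `` {x})"
  unfolding quotient_map_def topspace_quotient_topology openin_quotient_topology
  by (auto simp: quotient_def)

text \<open>
  The relation \<open>(e g, x) \<sim> (e, g x)\<close>. As \<open>G\<close> is a group, the relation listed here is already
  reflexive, symmetric and transitive.
\<close>

definition homotopy_orbit_rel ::
    "'p topology \<Rightarrow> ('p \<Rightarrow> 'g \<Rightarrow> 'p) \<Rightarrow> 'a topology \<Rightarrow> ('g \<Rightarrow> 'a \<Rightarrow> 'a) \<Rightarrow> (('p \<times> 'a) \<times> ('p \<times> 'a)) set" where
  "homotopy_orbit_rel P \<rho> X \<alpha> =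
     {((\<rho> e g, x), (e, \<alpha> g x)) |e g x. e \<in> topspace P \<and> x \<in> topspace X}"

lemma equiv_homotopy_orbit_rel:
  assumes "right_G_space P \<rho>" "left_G_space X \<alpha>"
  shows "equiv (topspace (prod_topology P X)) (homotopy_orbit_rel P \<rho> X \<alpha>)"
proof -
  have cr: "\<rho> e g \<in> topspace P" if "e \<in> topspace P" for e g
    using assms(1) that unfolding right_G_space_def continuous_map_def Pi_def by auto
  have cl: "\<alpha> g x \<in> topspace X" if "x \<in> topspace X" for x g
    using assms(2) that unfolding left_G_space_def continuous_map_def Pi_def by auto
  have r0: "\<rho> e 0 = e" "\<rho> (\<rho> e g) h = \<rho> e (g + h)" if "e \<in> topspace P" for e g h
    using assms(1) that unfolding right_G_space_def by auto
  have l0: "\<alpha> 0 x = x" "\<alpha> g (\<alpha> h x) = \<alpha> (g + h) x" if "x \<in> topspace X" for x g h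
    using assms(2) that unfolding left_G_space_def by auto
  have iff: "((e', x), (e, x')) \<in> homotopy_orbit_rel P \<rho> X \<alpha> \<longleftrightarrow>
      e \<in> topspace P \<and> x \<in> topspace X \<and> (\<exists>g. e' = \<rho> e g \<and> x' = \<alpha> g x)" for e e' x x'
    unfolding homotopy_orbit_rel_def by auto
  show ?thesis
  proof (rule equivI)
    show "homotopy_orbit_rel P \<rho> X \<alpha> \<subseteq> topspace (prod_topology P X) \<times> topspace (prod_topology P X)"
      by (auto simp: homotopy_orbit_rel_def cr cl)
    show "refl_on (topspace (prod_topology P X)) (homotopy_orbit_rel P \<rho> X \<alpha>)"
    proof (rule refl_onI)
      fix z assume "z \<in> topspace (prod_topology P X)"
      then obtain e x where z: "z = (e, x)" "e \<in> topspace P" "x \<in> topspace X" by auto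
      then show "(z, z) \<in> homotopy_orbit_rel P \<rho> X \<alpha>" by (metis iff r0(1) l0(1))
    qed
    show "sym (homotopy_orbit_rel P \<rho> X \<alpha>)"
    proof (rule symI)
      fix z w assume zw: "(z, w) \<in> homotopy_orbit_rel P \<rho> X \<alpha>"
      obtain e' x e x' where eq: "z = (e', x)" "w = (e, x')" by (metis surj_pair)
      obtain g where g: "e \<in> topspace P" "x \<in> topspace X" "e' = \<rho> e g" "x' = \<alpha> g x"
        using zw by (auto simp: eq iff)
      have "e = \<rho> e' (- g)" "x = \<alpha> (- g) x'" using g by (simp_all add: r0 l0)
      then show "(w, z) \<in> homotopy_orbit_rel P \<rho> X \<alpha>"
        using g cr cl by (auto simp: eq iff)
    qed
    show "trans (homotopy_orbit_rel P \<rho> X \<alpha>)"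
    proof (rule transI)
      fix z w v
      assume zw: "(z, w) \<in> homotopy_orbit_rel P \<rho> X \<alpha>" and wv: "(w, v) \<in> homotopy_orbit_rel P \<rho> X \<alpha>"
      obtain e1 x1 e2 x2 e3 x3 where eq: "z = (e1, x1)" "w = (e2, x2)" "v = (e3, x3)"
        by (metis surj_pair)
      obtain g where g: "x1 \<in> topspace X" "e1 = \<rho> e2 g" "x2 = \<alpha> g x1"
        using zw by (auto simp: eq iff)
      obtain h where h: "e3 \<in> topspace P" "e2 = \<rho> e3 h" "x3 = \<alpha> h x2"
        using wv by (auto simp: eq iff)
      have "e1 = \<rho> e3 (h + g)" "x3 = \<alpha> (h + g) x1" using g h by (simp_all add: r0 l0)
      then show "(z, v) \<in> homotopy_orbit_rel P \<rho> X \<alpha>" using g h by (auto simp: eq iff)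
    qed
  qed
qed

definition homotopy_orbit_space ::
    "'p topology \<Rightarrow> ('p \<Rightarrow> 'g \<Rightarrow> 'p) \<Rightarrow> 'a topology \<Rightarrow> ('g \<Rightarrow> 'a \<Rightarrow> 'a) \<Rightarrow> ('p \<times> 'a) set topology" where
  "homotopy_orbit_space P \<rho> X \<alpha> =
     quotient_topology (prod_topology P X) (homotopy_orbit_rel P \<rho> X \<alpha>)"

text \<open>
  The map \<open>[e, x] \<mapsto> [e, f x]\<close> induced by an equivariant \<open>f\<close>: the direct image of the class of
  \<open>(e, x)\<close> is the full class of \<open>(e, f x)\<close>.
\<close>

definition homotopy_orbit_map :: "('a \<Rightarrow> 'b) \<Rightarrow> ('p \<times> 'a) set \<Rightarrow> ('p \<times> 'b) set" where
  "homotopy_orbit_map f c = (\<lambda>(e, x). (e, f x)) ` c"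

lemma homotopy_orbit_map_class:
  assumes "right_G_space P \<rho>" "left_G_space X \<alpha>" "left_G_space Y \<beta>" "G_map X \<alpha> Y \<beta> f"
    and "e \<in> topspace P" "x \<in> topspace X"
  shows "homotopy_orbit_map f (homotopy_orbit_rel P \<rho> X \<alpha> `` {(e, x)}) =
         homotopy_orbit_rel P \<rho> Y \<beta> `` {(e, f x)}"
proof -
  have f: "f y \<in> topspace Y" "f (\<alpha> g y) = \<beta> g (f y)" if "y \<in> topspace X" for y g
    using assms(4) that unfolding G_map_def equivariant_on_def continuous_map_def by auto
  show ?thesis
  proof (intro equalityI subsetI)
    fix w assume "w \<in> homotopy_orbit_map f (homotopy_orbit_rel P \<rho> X \<alpha> `` {(e, x)})"
    then show "w \<in> homotopy_orbit_rel P \<rho> Y \<beta> `` {(e, f x)}"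
      using f assms(6) by (auto simp: homotopy_orbit_map_def homotopy_orbit_rel_def)
  next
    fix w assume "w \<in> homotopy_orbit_rel P \<rho> Y \<beta> `` {(e, f x)}"
    then obtain e' g where w: "e = \<rho> e' g" "w = (e', \<beta> g (f x))" "e' \<in> topspace P"
      by (auto simp: homotopy_orbit_rel_def)
    then have "(e', \<alpha> g x) \<in> homotopy_orbit_rel P \<rho> X \<alpha> `` {(e, x)}"
      using assms(6) by (auto simp: homotopy_orbit_rel_def)
    then show "w \<in> homotopy_orbit_map f (homotopy_orbit_rel P \<rho> X \<alpha> `` {(e, x)})"
      unfolding homotopy_orbit_map_def
      by (rule image_eqI[rotated]) (use w f assms(6) in simp)
  qed
qed

section \<open>The singular cohomology ring\<close>

text \<open>
  The cochain group is the direct sum of the groups \<open>C\<^sup>n(X; R)\<close> over all degrees \<open>n\<close>: an element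
  \<open>c\<close> has components \<open>c n\<close>, almost all of them zero, and \<open>c n\<close> assigns an element of \<open>R\<close> to each
  singular \<open>n\<close>-simplex of \<open>X\<close>; the value \<open>0\<close> elsewhere is only a normalisation. Its cohomology is
  the direct sum of the groups \<open>H\<^sup>n(X; R)\<close>, so cohomology classes need not be homogeneous.
\<close>

type_synonym ('a, 'r) cochain = "nat \<Rightarrow> ((nat \<Rightarrow> real) \<Rightarrow> 'a) \<Rightarrow> 'r"

definition cochains :: "'a topology \<Rightarrow> ('a, 'r::comm_ring_1) cochain set" where
  "cochains X =
     {c. (\<forall>n \<sigma>. \<not> singular_simplex n X \<sigma> \<longrightarrow> c n \<sigma> = 0) \<and> finite {n. \<exists>\<sigma>. c n \<sigma> \<noteq> 0}}"

definition coboundary :: "'a topology \<Rightarrow> ('a, 'r::comm_ring_1) cochain \<Rightarrow> ('a, 'r) cochain" where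
  "coboundary X c n \<sigma> =
     (if 1 \<le> n \<and> singular_simplex n X \<sigma>
      then \<Sum>k\<le>n. (- 1) ^ k * c (n - 1) (singular_face n k \<sigma>) else 0)"

definition cocycles :: "'a topology \<Rightarrow> ('a, 'r::comm_ring_1) cochain set" where
  "cocycles X = {c \<in> cochains X. coboundary X c = (\<lambda>n \<sigma>. 0)}"

definition cohomologous :: "'a topology \<Rightarrow> (('a, 'r::comm_ring_1) cochain \<times> ('a, 'r) cochain) set" where
  "cohomologous X =
     {(c, d). c \<in> cocycles X \<and> d \<in> cocycles X \<and>
        (\<exists>b\<in>cochains X. (\<lambda>n \<sigma>. c n \<sigma> - d n \<sigma>) = coboundary X b)}"

definition cohomology :: "'a topology \<Rightarrow> ('a, 'r::comm_ring_1) cochain set set" where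
  "cohomology X = cocycles X // cohomologous X"

definition coh_zero :: "'a topology \<Rightarrow> ('a, 'r::comm_ring_1) cochain set" where
  "coh_zero X = cohomologous X `` {\<lambda>n \<sigma>. 0}"

definition coh_one :: "'a topology \<Rightarrow> ('a, 'r::comm_ring_1) cochain set" where
  "coh_one X = cohomologous X `` {\<lambda>n \<sigma>. if n = 0 \<and> singular_simplex 0 X \<sigma> then 1 else 0}"

text \<open>The faces of a simplex spanned by its vertices \<open>0, \<dots>, p\<close> and \<open>p, \<dots>, p + q\<close>.\<close>

definition front_face :: "nat \<Rightarrow> ((nat \<Rightarrow> real) \<Rightarrow> 'a) \<Rightarrow> (nat \<Rightarrow> real) \<Rightarrow> 'a" where
  "front_face p \<sigma> = restrict \<sigma> (standard_simplex p)"

definition back_face :: "nat \<Rightarrow> nat \<Rightarrow> ((nat \<Rightarrow> real) \<Rightarrow> 'a) \<Rightarrow> (nat \<Rightarrow> real) \<Rightarrow> 'a" where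
  "back_face p q \<sigma> =
     restrict (\<lambda>x. \<sigma> (\<lambda>i. if i < p then 0 else x (i - p))) (standard_simplex q)"

definition cup_cochain ::
    "'a topology \<Rightarrow> ('a, 'r::comm_ring_1) cochain \<Rightarrow> ('a, 'r) cochain \<Rightarrow> ('a, 'r) cochain" where
  "cup_cochain X c d n \<sigma> =
     (if singular_simplex n X \<sigma>
      then \<Sum>p\<le>n. c p (front_face p \<sigma>) * d (n - p) (back_face p (n - p) \<sigma>) else 0)"

text \<open>
  Operations on classes are defined as unions over all representatives; the classes united are
  all equal.
\<close>

definition cup ::
    "'a topology \<Rightarrow> ('a, 'r::comm_ring_1) cochain set \<Rightarrow> ('a, 'r) cochain set \<Rightarrow> ('a, 'r) cochain set" where
  "cup X u v = (\<Union>c\<in>u. \<Union>d\<in>v. cohomologous X `` {cup_cochain X c d})"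

primrec cup_prod ::
    "'a topology \<Rightarrow> (nat \<Rightarrow> ('a, 'r::comm_ring_1) cochain set) \<Rightarrow> nat \<Rightarrow> ('a, 'r) cochain set" where
  "cup_prod X u 0 = coh_one X"
| "cup_prod X u (Suc k) = cup X (cup_prod X u k) (u (Suc k))"

definition pullback_cochain ::
    "'a topology \<Rightarrow> ('a \<Rightarrow> 'b) \<Rightarrow> ('b, 'r::comm_ring_1) cochain \<Rightarrow> ('a, 'r) cochain" where
  "pullback_cochain X f c n \<sigma> = (if singular_simplex n X \<sigma> then c n (simplex_map n f \<sigma>) else 0)"

text \<open>The homomorphism from the cohomology of \<open>Y\<close> to that of \<open>X\<close> induced by \<open>f: X \<rightarrow> Y\<close>.\<close>

definition induced ::
    "'a topology \<Rightarrow> ('a \<Rightarrow> 'b) \<Rightarrow> ('b, 'r::comm_ring_1) cochain set \<Rightarrow> ('a, 'r) cochain set" where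
  "induced X f u = (\<Union>c\<in>u. cohomologous X `` {pullback_cochain X f c})"

text \<open>Reduced cohomology with respect to a base point \<open>x\<close>: the kernel of restriction to \<open>x\<close>.\<close>

definition reduced_cohomology :: "'a topology \<Rightarrow> 'a \<Rightarrow> ('a, 'r::comm_ring_1) cochain set set" where
  "reduced_cohomology X x =
     {u \<in> cohomology X. induced (subtopology X {x}) (\<lambda>y. y) u = coh_zero (subtopology X {x})}"

end

theory Submission
  imports Defs "HOL-Analysis.Abstract_Topological_Spaces"
begin

text \<open>
  Suppose that \<open>B\<close> is covered by invariant open sets \<open>U\<^sub>1, \<dots>, U\<^sub>k\<close> with equivariant maps
  \<open>s\<^sub>i: U\<^sub>i \<rightarrow> E\<close> such that \<open>p \<circ> s\<^sub>i\<close> is equivariantly homotopic to the inclusion. The homotopy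
  orbit space of \<open>U\<^sub>i\<close> is an open subspace \<open>V\<^sub>i\<close> of that of \<open>B\<close>
  (\<open>homotopy_orbit_space_open_subset\<close>), the \<open>V\<^sub>i\<close> cover it, and equivariantly homotopic maps induce
  homotopic maps of homotopy orbit spaces (\<open>homotopic_homotopy_orbit_map\<close>). So the inclusion of \<open>V\<^sub>i\<close>
  factors up to homotopy through the map induced by \<open>p\<close>. As cohomology is homotopy invariant
  (\<open>homotopic_imp_cohomologous_pullback\<close>) and the map induced by \<open>p\<close> annihilates \<open>u\<^sub>i\<close>, the class
  \<open>u\<^sub>i\<close> restricts to zero on \<open>V\<^sub>i\<close>. Then \<open>u\<^sub>1 \<smile> \<dots> \<smile> u\<^sub>k\<close> is zero
  (\<open>cup_prod_eq_zero_of_open_cover\<close>), so a nonzero product excludes covers with \<open>k\<close> members, and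
  also covers with fewer members, to which empty sets can be added.

  The last step is carried out with cochains instead of relative cohomology groups. Each \<open>u\<^sub>i\<close> has a
  representative that vanishes on the simplices in \<open>V\<^sub>i\<close>, so the product of these cocycles vanishes
  on every simplex that lies in some \<open>V\<^sub>i\<close>. Barycentric subdivision shows that such a cocycle is a
  coboundary (\<open>cocycle_vanishing_on_small_simplices\<close>). That classes can be multiplied through chosen
  representatives is the Leibniz rule (\<open>coboundary_cup_cochain\<close>). Homotopy invariance comes from a
  natural chain homotopy, which is obtained from acyclic models (\<open>prism_models\<close>).
\<close>

section \<open>Cochains as functionals on chains\<close>

text \<open>
  The linear extension of a cochain from simplices to integral chains. It turns identities between
  chain maps and chain homotopies into identities between cochains with coefficients in any
  commutative ring.
\<close>

definition chain_eval :: "('s \<Rightarrow> 'r::comm_ring_1) \<Rightarrow> ('s \<Rightarrow>\<^sub>0 int) \<Rightarrow> 'r" where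
  "chain_eval c x = (\<Sum>f\<in>Poly_Mapping.keys x. of_int (Poly_Mapping.lookup x f) * c f)"

lemma chain_eval_superset:
  assumes "finite A" "Poly_Mapping.keys x \<subseteq> A"
  shows "chain_eval c x = (\<Sum>f\<in>A. of_int (Poly_Mapping.lookup x f) * c f)"
  unfolding chain_eval_def using assms
  by (intro sum.mono_neutral_left) (auto simp: in_keys_iff)

lemma chain_eval_0 [simp]: "chain_eval c 0 = 0"
  by (simp add: chain_eval_def)

lemma chain_eval_of [simp]: "chain_eval c (frag_of f) = c f"
  by (simp add: chain_eval_def)

lemma chain_eval_add: "chain_eval c (x + y) = chain_eval c x + chain_eval c y"
proof -
  let ?A = "Poly_Mapping.keys x \<union> Poly_Mapping.keys y"
  have "Poly_Mapping.keys (x + y) \<subseteq> ?A"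
    by (rule keys_add)
  then show ?thesis
    by (simp add: chain_eval_superset [of ?A] lookup_add distrib_right sum.distrib)
qed

lemma chain_eval_cmul: "chain_eval c (frag_cmul a x) = of_int a * chain_eval c x"
proof -
  have "Poly_Mapping.keys (frag_cmul a x) \<subseteq> Poly_Mapping.keys x"
    by (rule keys_cmul)
  then show ?thesis
    by (simp add: chain_eval_superset [of "Poly_Mapping.keys x"] sum_distrib_left mult.assoc)
qed

lemma chain_eval_minus: "chain_eval c (- x) = - chain_eval c x"
  using chain_eval_cmul [of c "-1" x] by simp

lemma chain_eval_diff: "chain_eval c (x - y) = chain_eval c x - chain_eval c y"
  using chain_eval_add [of c x "- y"] by (simp add: chain_eval_minus)

lemma chain_eval_sum: "chain_eval c (sum x I) = (\<Sum>i\<in>I. chain_eval c (x i))"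
  by (induction I rule: infinite_finite_induct) (simp_all add: chain_eval_add)

lemma chain_eval_eq_0:
  "(\<And>f. f \<in> Poly_Mapping.keys x \<Longrightarrow> c f = 0) \<Longrightarrow> chain_eval c x = 0"
  by (simp add: chain_eval_def)

lemma coboundary_eq_chain_eval:
  assumes "singular_simplex n X \<sigma>"
  shows "coboundary X c n \<sigma> = chain_eval (c (n - 1)) (chain_boundary n (frag_of \<sigma>))"
  using assms
  by (auto simp: coboundary_def chain_boundary_of chain_eval_sum chain_eval_cmul)

lemma chain_eval_coboundary:
  assumes "singular_chain n X x"
  shows "chain_eval (coboundary X c n) x = chain_eval (c (n - 1)) (chain_boundary n x)"
  using assms unfolding singular_chain_def
  by (induction rule: frag_induction)
    (auto simp: coboundary_eq_chain_eval chain_eval_diff chain_boundary_diff)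

text \<open>
  The dual of \<open>\<partial>\<partial> = 0\<close>, through the description of the coboundary as evaluation on the boundary.
\<close>

lemma coboundary_coboundary: "coboundary X (coboundary X c) = (\<lambda>n \<sigma>. 0)"
proof (intro ext)
  fix n \<sigma>
  show "coboundary X (coboundary X c) n \<sigma> = 0"
  proof (cases "singular_simplex n X \<sigma>")
    case True
    then have ch: "singular_chain n X (frag_of \<sigma>)"
      by (simp add: singular_chain_of)
    have "coboundary X (coboundary X c) n \<sigma> =
        chain_eval (coboundary X c (n - 1)) (chain_boundary n (frag_of \<sigma>))"
      by (rule coboundary_eq_chain_eval [OF True])
    also have "\<dots> = chain_eval (c (n - 1 - 1)) (chain_boundary (n - 1) (chain_boundary n (frag_of \<sigma>)))"
      using singular_chain_boundary [OF ch] by (simp add: chain_eval_coboundary)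
    also have "\<dots> = 0"
      using chain_boundary_boundary [OF ch] by simp
    finally show ?thesis .
  qed (simp add: coboundary_def)
qed

lemma cocycle_eval_boundary:
  assumes "z \<in> cocycles X" "singular_chain (Suc n) X x"
  shows "chain_eval (z n) (chain_boundary (Suc n) x) = 0"
proof -
  have "chain_eval (z n) (chain_boundary (Suc n) x) = chain_eval (coboundary X z (Suc n)) x"
    using chain_eval_coboundary [OF assms(2), of z] by simp
  also have "\<dots> = 0"
    using assms(1) by (intro chain_eval_eq_0) (simp add: cocycles_def)
  finally show ?thesis .
qed

section \<open>Cohomology classes\<close>

lemma cochainsI:
  assumes "\<And>n \<sigma>. \<not> singular_simplex n X \<sigma> \<Longrightarrow> c n \<sigma> = 0"
    and "finite A" "\<And>n \<sigma>. n \<notin> A \<Longrightarrow> c n \<sigma> = 0"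
  shows "c \<in> cochains X"
  unfolding cochains_def
proof (intro CollectI conjI allI impI)
  show "finite {n. \<exists>\<sigma>. c n \<sigma> \<noteq> 0}"
    by (rule finite_subset [OF _ assms(2)]) (use assms(3) in blast)
qed (use assms in blast)

lemma cochainsE:
  assumes "c \<in> cochains X"
  obtains A where "finite A" "\<And>n \<sigma>. n \<notin> A \<Longrightarrow> c n \<sigma> = 0"
    "\<And>n \<sigma>. \<not> singular_simplex n X \<sigma> \<Longrightarrow> c n \<sigma> = 0"
  using assms that [of "{n. \<exists>\<sigma>. c n \<sigma> \<noteq> 0}"] unfolding cochains_def by blast

lemma zero_in_cochains [simp]: "(\<lambda>n \<sigma>. 0) \<in> cochains X"
  by (simp add: cochains_def)

lemma diff_in_cochains:
  assumes "c \<in> cochains X" "d \<in> cochains X"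
  shows "(\<lambda>n \<sigma>. c n \<sigma> - d n \<sigma>) \<in> cochains X"
proof -
  obtain A where A: "finite A" "\<And>n \<sigma>. n \<notin> A \<Longrightarrow> c n \<sigma> = 0"
      "\<And>n \<sigma>. \<not> singular_simplex n X \<sigma> \<Longrightarrow> c n \<sigma> = 0"
    using assms(1) by (rule cochainsE) blast
  obtain B where "finite B" "\<And>n \<sigma>. n \<notin> B \<Longrightarrow> d n \<sigma> = 0"
      "\<And>n \<sigma>. \<not> singular_simplex n X \<sigma> \<Longrightarrow> d n \<sigma> = 0"
    using assms(2) by (rule cochainsE) blast
  with A show ?thesis
    by (intro cochainsI [where A = "A \<union> B"]) auto
qed

lemma add_in_cochains:
  assumes "c \<in> cochains X" "d \<in> cochains X"
  shows "(\<lambda>n \<sigma>. c n \<sigma> + d n \<sigma>) \<in> cochains X"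
  using diff_in_cochains [OF assms(1) diff_in_cochains [OF zero_in_cochains assms(2)]] by simp

lemma coboundary_in_cochains:
  assumes "c \<in> cochains X"
  shows "coboundary X c \<in> cochains X"
proof -
  obtain A where "finite A" "\<And>n \<sigma>. n \<notin> A \<Longrightarrow> c n \<sigma> = 0"
    using assms by (rule cochainsE) blast
  then have "coboundary X c n \<sigma> = 0" if "n \<notin> Suc ` A" for n \<sigma>
    using that by (cases n) (auto simp: coboundary_def image_iff simp del: sum.atMost_Suc)
  with \<open>finite A\<close> show ?thesis
    by (intro cochainsI [where A = "Suc ` A"]) (auto simp: coboundary_def)
qed

lemma coboundary_0 [simp]: "coboundary X (\<lambda>n \<sigma>. 0) = (\<lambda>n \<sigma>. 0)"
  by (intro ext) (simp add: coboundary_def)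

lemma coboundary_diff:
  "coboundary X (\<lambda>n \<sigma>. c n \<sigma> - d n \<sigma>) = (\<lambda>n \<sigma>. coboundary X c n \<sigma> - coboundary X d n \<sigma>)"
  by (intro ext) (simp add: coboundary_def right_diff_distrib sum_subtractf)

lemma coboundary_add:
  "coboundary X (\<lambda>n \<sigma>. c n \<sigma> + d n \<sigma>) = (\<lambda>n \<sigma>. coboundary X c n \<sigma> + coboundary X d n \<sigma>)"
  by (intro ext) (simp add: coboundary_def distrib_left sum.distrib)

lemma cocycle_in_cochains: "c \<in> cocycles X \<Longrightarrow> c \<in> cochains X"
  by (simp add: cocycles_def)

lemma zero_in_cocycles [simp]: "(\<lambda>n \<sigma>. 0) \<in> cocycles X"
  by (simp add: cocycles_def)

lemma coboundary_in_cocycles: "b \<in> cochains X \<Longrightarrow> coboundary X b \<in> cocycles X"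
  by (simp add: cocycles_def coboundary_in_cochains coboundary_coboundary)

lemma diff_in_cocycles:
  "c \<in> cocycles X \<Longrightarrow> d \<in> cocycles X \<Longrightarrow> (\<lambda>n \<sigma>. c n \<sigma> - d n \<sigma>) \<in> cocycles X"
  by (simp add: cocycles_def diff_in_cochains coboundary_diff)

lemma cohomologousI:
  assumes "c \<in> cocycles X" "d \<in> cocycles X" "b \<in> cochains X"
    and "\<And>n \<sigma>. c n \<sigma> - d n \<sigma> = coboundary X b n \<sigma>"
  shows "(c, d) \<in> cohomologous X"
  using assms unfolding cohomologous_def by blast

lemma cohomologousE:
  assumes "(c, d) \<in> cohomologous X"
  obtains b where "c \<in> cocycles X" "d \<in> cocycles X" "b \<in> cochains X"
    "\<And>n \<sigma>. c n \<sigma> - d n \<sigma> = coboundary X b n \<sigma>"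
  using assms unfolding cohomologous_def by (auto dest: fun_cong)

lemma equiv_cohomologous:
  fixes X :: "'a topology"
  shows "equiv (cocycles X :: ('a, 'r::comm_ring_1) cochain set) (cohomologous X)"
    (is "equiv _ ?C")
proof (rule equivI)
  show "?C \<subseteq> cocycles X \<times> cocycles X"
    by (auto simp: cohomologous_def)
  show "refl_on (cocycles X) (?C)"
    by (rule refl_onI, rule cohomologousI [where b = "\<lambda>n \<sigma>. 0"]) auto
  show "sym (?C)"
  proof (rule symI)
    fix c d :: "('a, 'r) cochain"
    assume "(c, d) \<in> ?C"
    then obtain b where b: "c \<in> cocycles X" "d \<in> cocycles X" "b \<in> cochains X"
        "\<And>n \<sigma>. c n \<sigma> - d n \<sigma> = coboundary X b n \<sigma>"
      by (rule cohomologousE) blast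
    show "(d, c) \<in> ?C"
    proof (rule cohomologousI [OF b(2,1) diff_in_cochains [OF zero_in_cochains b(3)]])
      show "d n \<sigma> - c n \<sigma> = coboundary X (\<lambda>n \<sigma>. 0 - b n \<sigma>) n \<sigma>" for n \<sigma>
        unfolding coboundary_diff b(4) [symmetric] by simp
    qed
  qed
  show "trans (?C)"
  proof (rule transI)
    fix c d e :: "('a, 'r) cochain"
    assume cd: "(c, d) \<in> ?C" and de: "(d, e) \<in> ?C"
    obtain b where b: "c \<in> cocycles X" "b \<in> cochains X"
        "\<And>n \<sigma>. c n \<sigma> - d n \<sigma> = coboundary X b n \<sigma>"
      using cd by (rule cohomologousE) blast
    obtain b' where b': "e \<in> cocycles X" "b' \<in> cochains X"
        "\<And>n \<sigma>. d n \<sigma> - e n \<sigma> = coboundary X b' n \<sigma>"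
      using de by (rule cohomologousE) blast
    show "(c, e) \<in> ?C"
    proof (rule cohomologousI [OF b(1) b'(1) add_in_cochains [OF b(2) b'(2)]])
      show "c n \<sigma> - e n \<sigma> = coboundary X (\<lambda>n \<sigma>. b n \<sigma> + b' n \<sigma>) n \<sigma>" for n \<sigma>
        unfolding coboundary_add b(3) [symmetric] b'(3) [symmetric] by simp
    qed
  qed
qed

lemma cohomologous_trans:
  "(c, d) \<in> cohomologous X \<Longrightarrow> (d, e) \<in> cohomologous X \<Longrightarrow> (c, e) \<in> cohomologous X"
  using equiv_cohomologous by (rule equivE) (erule (2) transD)

lemma cohomologous_refl: "c \<in> cocycles X \<Longrightarrow> (c, c) \<in> cohomologous X"
  using equiv_cohomologous by (rule equivE) (erule (1) refl_onD)

lemma cohomology_representative: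
  assumes "u \<in> cohomology X"
  obtains c where "c \<in> cocycles X" "u = cohomologous X `` {c}"
  using assms unfolding cohomology_def by (elim quotientE)

lemma coh_zero_eq_class:
  assumes "(c, \<lambda>n \<sigma>. 0) \<in> cohomologous X"
  shows "cohomologous X `` {c} = coh_zero X"
  unfolding coh_zero_def by (rule equiv_class_eq [OF equiv_cohomologous assms])

section \<open>The cup product of cohomology classes\<close>

lemma front_face_in_standard_simplex:
  "\<lbrakk>p \<le> n; x \<in> standard_simplex p\<rbrakk> \<Longrightarrow> x \<in> standard_simplex n"
  using standard_simplex_mono by blast

lemma back_face_in_standard_simplex:
  assumes "x \<in> standard_simplex q"
  shows "(\<lambda>i. if i < p then 0 else x (i - p)) \<in> standard_simplex (p + q)"
proof -
  have "(\<Sum>i\<le>p + q. if i < p then 0 else x (i - p)) =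
      (\<Sum>i\<in>{p..p + q}. if i < p then 0 else x (i - p))"
    by (rule sum.mono_neutral_right) auto
  also have "\<dots> = (\<Sum>i\<le>q. x i)"
    by (rule sum.reindex_bij_witness [where i = "\<lambda>i. i + p" and j = "\<lambda>i. i - p"]) auto
  also have "\<dots> = 1"
    using assms by (simp add: standard_simplex_def)
  finally show ?thesis
    using assms by (auto simp: standard_simplex_def)
qed

lemma singular_simplex_front_face:
  assumes "singular_simplex n X \<sigma>" "p \<le> n"
  shows "singular_simplex p X (front_face p \<sigma>)"
  using assms standard_simplex_mono [OF assms(2)]
  unfolding singular_simplex_def front_face_def
  by (auto intro: continuous_map_from_subtopology_mono)

lemma singular_simplex_back_face:
  assumes "singular_simplex (p + q) X \<sigma>"
  shows "singular_simplex q X (back_face p q \<sigma>)"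
proof -
  let ?b = "\<lambda>x i. if i < p then 0 else x (i - p) :: real"
  have "continuous_map (subtopology (powertop_real UNIV) (standard_simplex q)) euclideanreal (\<lambda>x. ?b x i)" for i
    by (cases "i < p") (auto intro: continuous_map_product_projection continuous_map_from_subtopology)
  then have "continuous_map (subtopology (powertop_real UNIV) (standard_simplex q))
      (subtopology (powertop_real UNIV) (standard_simplex (p + q))) ?b"
    using back_face_in_standard_simplex
    by (auto simp: continuous_map_in_subtopology continuous_map_componentwise_UNIV)
  then have "continuous_map (subtopology (powertop_real UNIV) (standard_simplex q)) X (\<sigma> \<circ> ?b)"
    using assms continuous_map_compose unfolding singular_simplex_def by blast
  then show ?thesis
    by (simp add: singular_simplex_def back_face_def o_def)
qed

text \<open>
  A face of a simplex with vertices \<open>0, \<dots>, n + 1\<close> omits one vertex \<open>k\<close>. Splitting the face at its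
  \<open>p\<close>-th vertex, the omitted vertex lies in the front part if \<open>k \<le> p\<close> and in the back part if
  \<open>p < k\<close>; the next four lemmas express the two parts by faces of front and back parts of the
  original simplex.
\<close>

lemma front_face_singular_face_le:
  assumes "k \<le> p" "p \<le> n"
  shows "front_face p (singular_face (Suc n) k \<sigma>) = singular_face (Suc p) k (front_face (Suc p) \<sigma>)"
proof
  fix x :: "nat \<Rightarrow> real"
  have "simplical_face k x \<in> standard_simplex (Suc p)" if "x \<in> standard_simplex p"
    using simplical_face_in_standard_simplex [of "Suc p" k x] assms that by simp
  then show "front_face p (singular_face (Suc n) k \<sigma>) x = singular_face (Suc p) k (front_face (Suc p) \<sigma>) x"
    using front_face_in_standard_simplex [OF assms(2)]
    by (simp add: front_face_def singular_face_def)
qed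

lemma front_face_singular_face_gt:
  assumes "p < k" "p \<le> n"
  shows "front_face p (singular_face (Suc n) k \<sigma>) = front_face p \<sigma>"
proof
  fix x :: "nat \<Rightarrow> real"
  have "simplical_face k x = x" if "x \<in> standard_simplex p"
    using that assms(1) by (fastforce simp: simplical_face_def standard_simplex_def)
  then show "front_face p (singular_face (Suc n) k \<sigma>) x = front_face p \<sigma> x"
    using front_face_in_standard_simplex [OF assms(2)]
    by (simp add: front_face_def singular_face_def)
qed

lemma back_face_singular_face_le:
  assumes "k \<le> p"
  shows "back_face p q (singular_face (Suc (p + q)) k \<sigma>) = back_face (Suc p) q \<sigma>"
proof
  fix x :: "nat \<Rightarrow> real"
  have "simplical_face k (\<lambda>i. if i < p then 0 else x (i - p)) = (\<lambda>i. if i < Suc p then 0 else x (i - Suc p))"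
    using assms by (auto simp: simplical_face_def fun_eq_iff)
  then show "back_face p q (singular_face (Suc (p + q)) k \<sigma>) x = back_face (Suc p) q \<sigma> x"
    using back_face_in_standard_simplex [of x q p]
    by (simp add: back_face_def singular_face_def)
qed

lemma back_face_singular_face_add:
  assumes "j \<le> Suc q" "1 \<le> j"
  shows "back_face p q (singular_face (Suc (p + q)) (p + j) \<sigma>) = singular_face (Suc q) j (back_face p (Suc q) \<sigma>)"
proof
  fix x :: "nat \<Rightarrow> real"
  have eq: "simplical_face (p + j) (\<lambda>i. if i < p then 0 else x (i - p)) =
      (\<lambda>i. if i < p then 0 else simplical_face j x (i - p))"
    using assms by (auto simp: simplical_face_def fun_eq_iff)
  have "simplical_face j x \<in> standard_simplex (Suc q)" if "x \<in> standard_simplex q"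
    using simplical_face_in_standard_simplex [of "Suc q" j x] assms that by simp
  then show "back_face p q (singular_face (Suc (p + q)) (p + j) \<sigma>) x =
      singular_face (Suc q) j (back_face p (Suc q) \<sigma>) x"
    using back_face_in_standard_simplex [of x q p] eq
    by (simp add: back_face_def singular_face_def)
qed

text \<open>
  Two ways of passing to a shorter part: the last face of the front part and the first face of the
  back part. In the Leibniz rule these are the terms that occur twice, with opposite signs.
\<close>

lemma singular_face_last_front_face:
  "singular_face (Suc p) (Suc p) (front_face (Suc p) \<sigma>) = front_face p \<sigma>"
proof
  fix x :: "nat \<Rightarrow> real"
  have "simplical_face (Suc p) x = x" if "x \<in> standard_simplex p"
    using that by (fastforce simp: simplical_face_def standard_simplex_def)
  then show "singular_face (Suc p) (Suc p) (front_face (Suc p) \<sigma>) x = front_face p \<sigma> x"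
    using standard_simplex_mono [of p "Suc p"]
    by (auto simp: front_face_def singular_face_def)
qed

lemma singular_face_0_back_face:
  "singular_face (Suc q) 0 (back_face p (Suc q) \<sigma>) = back_face (Suc p) q \<sigma>"
proof
  fix x :: "nat \<Rightarrow> real"
  have eq: "(\<lambda>i. if i < p then 0 else simplical_face 0 x (i - p)) = (\<lambda>i. if i < Suc p then 0 else x (i - Suc p))"
    by (auto simp: simplical_face_def fun_eq_iff)
  have "simplical_face 0 x \<in> standard_simplex (Suc q)" if "x \<in> standard_simplex q"
    using simplical_face_in_standard_simplex [of "Suc q" 0 x] that by simp
  then show "singular_face (Suc q) 0 (back_face p (Suc q) \<sigma>) x = back_face (Suc p) q \<sigma> x"
    using eq by (simp add: back_face_def singular_face_def)
qed

text \<open>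
  For a cochain that need not be homogeneous, the sign \<open>(-1)\<^sup>p\<close> of the Leibniz rule depends on the
  component, so it is attached to the cochain.
\<close>

definition sign_twist :: "('a, 'r::comm_ring_1) cochain \<Rightarrow> ('a, 'r) cochain" where
  "sign_twist c n \<sigma> = (- 1) ^ n * c n \<sigma>"

text \<open>
  The Leibniz rule \<open>\<delta>(c \<smile> d) = \<delta>c \<smile> d \<plusminus> c \<smile> \<delta>d\<close>. For a fixed splitting degree \<open>p\<close> the faces
  \<open>k \<le> p\<close> give the faces of the front part except the last one, and the faces \<open>k > p\<close> give the
  faces of the back part except the first one.
\<close>

lemma coboundary_cup_cochain:
  fixes c d :: "('a, 'r::comm_ring_1) cochain"
  shows "coboundary X (cup_cochain X c d) n \<sigma> =
     cup_cochain X (coboundary X c) d n \<sigma> + cup_cochain X (sign_twist c) (coboundary X d) n \<sigma>"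
proof (cases "singular_simplex n X \<sigma> \<and> 1 \<le> n")
  case False
  then show ?thesis
    by (auto simp: coboundary_def cup_cochain_def)
next
  case True
  then obtain m where n: "n = Suc m" and \<sigma>: "singular_simplex (Suc m) X \<sigma>"
    by (cases n) auto
  define F where "F p k = c p (singular_face (Suc p) k (front_face (Suc p) \<sigma>))" for p k
  define G where "G p j = d (m - p) (singular_face (Suc (m - p)) j (back_face p (Suc (m - p)) \<sigma>))" for p j
  have front: "singular_simplex p X (front_face p \<sigma>)" if "p \<le> Suc m" for p
    using singular_simplex_front_face [OF \<sigma> that] .
  have bk: "singular_simplex (Suc m - p) X (back_face p (Suc m - p) \<sigma>)" if "p \<le> Suc m" for p
    by (rule singular_simplex_back_face) (use that \<sigma> in simp)
  have face: "singular_simplex m X (singular_face (Suc m) k \<sigma>)" if "k \<le> Suc m" for k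
    using singular_simplex_singular_face [OF \<sigma> _ that] by simp
  have term_le: "c p (front_face p (singular_face (Suc m) k \<sigma>)) * d (m - p) (back_face p (m - p) (singular_face (Suc m) k \<sigma>))
      = F p k * G p 0" if "p \<le> m" "k \<le> p" for p k
    using front_face_singular_face_le [OF that(2,1), of \<sigma>]
      back_face_singular_face_le [OF that(2), of "m - p" \<sigma>] that(1)
    by (simp add: F_def G_def singular_face_0_back_face)
  have term_gt: "c p (front_face p (singular_face (Suc m) (p + j) \<sigma>)) *
        d (m - p) (back_face p (m - p) (singular_face (Suc m) (p + j) \<sigma>))
      = F p (Suc p) * G p j" if "p \<le> m" "1 \<le> j" "j \<le> Suc (m - p)" for p j
    using front_face_singular_face_gt [of p "p + j" m \<sigma>]
      back_face_singular_face_add [OF that(3,2), of p \<sigma>] that(1,2)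
    by (simp add: F_def G_def singular_face_last_front_face)
  have split: "(\<Sum>k\<le>Suc m. H k) = (\<Sum>k\<le>p. H k) + (\<Sum>j=1..Suc (m - p). H (p + j))"
    if "p \<le> m" for p and H :: "nat \<Rightarrow> 'r"
  proof -
    have "{..Suc m} = {..p} \<union> {Suc p..Suc m}"
      using that by auto
    then have "(\<Sum>k\<le>Suc m. H k) = (\<Sum>k\<le>p. H k) + (\<Sum>k=Suc p..Suc m. H k)"
      by (simp add: sum.union_disjoint ivl_disj_int)
    also have "(\<Sum>k=Suc p..Suc m. H k) = (\<Sum>j=1..Suc (m - p). H (p + j))"
      by (rule sum.reindex_bij_witness [where i = "\<lambda>j. p + j" and j = "\<lambda>k. k - p"]) (use that in auto)
    finally show ?thesis .
  qed
  have "coboundary X (cup_cochain X c d) n \<sigma> =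
      (\<Sum>k\<le>Suc m. \<Sum>p\<le>m. (- 1) ^ k * (c p (front_face p (singular_face (Suc m) k \<sigma>)) *
          d (m - p) (back_face p (m - p) (singular_face (Suc m) k \<sigma>))))"
    using \<sigma> face by (simp add: coboundary_def cup_cochain_def n sum_distrib_left del: sum.atMost_Suc)
  also have "\<dots> = (\<Sum>p\<le>m. \<Sum>k\<le>Suc m. (- 1) ^ k * (c p (front_face p (singular_face (Suc m) k \<sigma>)) *
          d (m - p) (back_face p (m - p) (singular_face (Suc m) k \<sigma>))))"
    by (rule sum.swap)
  also have "\<dots> = (\<Sum>p\<le>m. (\<Sum>k\<le>p. (- 1) ^ k * (F p k * G p 0)) +
      (\<Sum>j=1..Suc (m - p). (- 1) ^ (p + j) * (F p (Suc p) * G p j)))"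
    proof (intro sum.cong refl, subst split)
    fix p assume p: "p \<in> {..m}"
    show "(\<Sum>k\<le>p. (- 1) ^ k * (c p (front_face p (singular_face (Suc m) k \<sigma>)) *
            d (m - p) (back_face p (m - p) (singular_face (Suc m) k \<sigma>)))) +
          (\<Sum>j=1..Suc (m - p). (- 1) ^ (p + j) * (c p (front_face p (singular_face (Suc m) (p + j) \<sigma>)) *
            d (m - p) (back_face p (m - p) (singular_face (Suc m) (p + j) \<sigma>)))) =
        (\<Sum>k\<le>p. (- 1) ^ k * (F p k * G p 0)) +
          (\<Sum>j=1..Suc (m - p). (- 1) ^ (p + j) * (F p (Suc p) * G p j))"
      using p by (intro arg_cong2 [where f = "(+)"] sum.cong refl) (simp_all add: term_le term_gt)
  qed simp
  (* the last face of the front part and the first face of the back part contribute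
     opposite terms, so both can be included *)
  also have "\<dots> = (\<Sum>p\<le>m. (\<Sum>k\<le>Suc p. (- 1) ^ k * F p k) * G p 0 +
      (- 1) ^ p * F p (Suc p) * (\<Sum>j\<le>Suc (m - p). (- 1) ^ j * G p j))"
  proof (intro sum.cong refl)
    fix p
    have "(\<Sum>j\<le>Suc (m - p). (- 1) ^ j * G p j) = G p 0 + (\<Sum>j=1..Suc (m - p). (- 1) ^ j * G p j)"
      by (simp add: atMost_atLeast0 sum.atLeast_Suc_atMost del: sum.cl_ivl_Suc)
    then show "(\<Sum>k\<le>p. (- 1) ^ k * (F p k * G p 0)) +
          (\<Sum>j=1..Suc (m - p). (- 1) ^ (p + j) * (F p (Suc p) * G p j)) =
        (\<Sum>k\<le>Suc p. (- 1) ^ k * F p k) * G p 0 +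
          (- 1) ^ p * F p (Suc p) * (\<Sum>j\<le>Suc (m - p). (- 1) ^ j * G p j)"
      by (simp add: sum_distrib_left sum_distrib_right power_add algebra_simps del: sum.cl_ivl_Suc)
  qed
  also have "\<dots> = (\<Sum>p\<le>m. (\<Sum>k\<le>Suc p. (- 1) ^ k * F p k) * G p 0) +
      (\<Sum>p\<le>m. (- 1) ^ p * F p (Suc p) * (\<Sum>j\<le>Suc (m - p). (- 1) ^ j * G p j))"
    by (rule sum.distrib)
  also have "(\<Sum>p\<le>m. (\<Sum>k\<le>Suc p. (- 1) ^ k * F p k) * G p 0) = cup_cochain X (coboundary X c) d n \<sigma>"
  proof -
    have "cup_cochain X (coboundary X c) d n \<sigma> = (\<Sum>p\<le>Suc m. coboundary X c p (front_face p \<sigma>) *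
        d (Suc m - p) (back_face p (Suc m - p) \<sigma>))"
      using \<sigma> by (simp add: cup_cochain_def n del: sum.atMost_Suc)
    also have "\<dots> = (\<Sum>p\<le>m. coboundary X c (Suc p) (front_face (Suc p) \<sigma>) *
        d (m - p) (back_face (Suc p) (m - p) \<sigma>))"
      by (subst sum.atMost_Suc_shift) (simp add: coboundary_def)
    finally show ?thesis
      using front by (simp add: coboundary_def F_def G_def singular_face_0_back_face del: sum.atMost_Suc)
  qed
  also have "(\<Sum>p\<le>m. (- 1) ^ p * F p (Suc p) * (\<Sum>j\<le>Suc (m - p). (- 1) ^ j * G p j)) =
      cup_cochain X (sign_twist c) (coboundary X d) n \<sigma>"
  proof -
    have "cup_cochain X (sign_twist c) (coboundary X d) n \<sigma> =
        (\<Sum>p\<le>Suc m. sign_twist c p (front_face p \<sigma>) * coboundary X d (Suc m - p) (back_face p (Suc m - p) \<sigma>))"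
      using \<sigma> by (simp add: cup_cochain_def n del: sum.atMost_Suc)
    also have "\<dots> = (\<Sum>p\<le>m. sign_twist c p (front_face p \<sigma>) * coboundary X d (Suc m - p) (back_face p (Suc m - p) \<sigma>))"
      by (simp add: coboundary_def)
    also have "\<dots> = (\<Sum>p\<le>m. (- 1) ^ p * F p (Suc p) * (\<Sum>j\<le>Suc (m - p). (- 1) ^ j * G p j))"
    proof (intro sum.cong refl)
      fix p assume "p \<in> {..m}"
      then have "Suc m - p = Suc (m - p)" "singular_simplex (Suc (m - p)) X (back_face p (Suc (m - p)) \<sigma>)"
        using bk [of p] by (simp_all add: Suc_diff_le)
      then show "sign_twist c p (front_face p \<sigma>) * coboundary X d (Suc m - p) (back_face p (Suc m - p) \<sigma>) =
          (- 1) ^ p * F p (Suc p) * (\<Sum>j\<le>Suc (m - p). (- 1) ^ j * G p j)"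
        by (simp add: coboundary_def sign_twist_def F_def G_def singular_face_last_front_face del: sum.atMost_Suc)
    qed
    finally show ?thesis by simp
  qed
  finally show ?thesis .
qed

lemma cup_cochain_in_cochains:
  assumes "c \<in> cochains X" "d \<in> cochains X"
  shows "cup_cochain X c d \<in> cochains X"
proof -
  obtain A where A: "finite A" "\<And>n \<sigma>. n \<notin> A \<Longrightarrow> c n \<sigma> = 0"
    using assms(1) by (rule cochainsE) blast
  obtain B where B: "finite B" "\<And>n \<sigma>. n \<notin> B \<Longrightarrow> d n \<sigma> = 0"
    using assms(2) by (rule cochainsE) blast
  show ?thesis
  proof (rule cochainsI [where A = "(\<lambda>(p, q). p + q) ` (A \<times> B)"])
    fix n \<sigma> assume n: "n \<notin> (\<lambda>(p, q). p + q) ` (A \<times> B)"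
    have "p \<notin> A \<or> n - p \<notin> B" if "p \<le> n" for p
      using n that by force
    then show "cup_cochain X c d n \<sigma> = 0"
      using A(2) B(2) by (fastforce simp: cup_cochain_def intro: sum.neutral)
  qed (use A B in \<open>auto simp: cup_cochain_def\<close>)
qed

lemma sign_twist_in_cochains:
  assumes "c \<in> cochains X"
  shows "sign_twist c \<in> cochains X"
proof -
  obtain A where "finite A" "\<And>n \<sigma>. n \<notin> A \<Longrightarrow> c n \<sigma> = 0"
      "\<And>n \<sigma>. \<not> singular_simplex n X \<sigma> \<Longrightarrow> c n \<sigma> = 0"
    using assms by (rule cochainsE) blast
  then show ?thesis
    by (intro cochainsI [where A = A]) (auto simp: sign_twist_def)
qed

lemma cup_cochain_0_left [simp]: "cup_cochain X (\<lambda>n \<sigma>. 0) d = (\<lambda>n \<sigma>. 0)"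
  by (intro ext) (simp add: cup_cochain_def)

lemma cup_cochain_0_right [simp]: "cup_cochain X c (\<lambda>n \<sigma>. 0) = (\<lambda>n \<sigma>. 0)"
  by (intro ext) (simp add: cup_cochain_def)

lemma cup_cochain_diff_left:
  "cup_cochain X (\<lambda>n \<sigma>. c n \<sigma> - c' n \<sigma>) d n \<sigma> = cup_cochain X c d n \<sigma> - cup_cochain X c' d n \<sigma>"
  by (simp add: cup_cochain_def left_diff_distrib sum_subtractf)

lemma cup_cochain_diff_right:
  "cup_cochain X c (\<lambda>n \<sigma>. d n \<sigma> - d' n \<sigma>) n \<sigma> = cup_cochain X c d n \<sigma> - cup_cochain X c d' n \<sigma>"
  by (simp add: cup_cochain_def right_diff_distrib sum_subtractf)

lemma cup_cochain_in_cocycles: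
  assumes "c \<in> cocycles X" "d \<in> cocycles X"
  shows "cup_cochain X c d \<in> cocycles X"
proof -
  have "coboundary X (cup_cochain X c d) = (\<lambda>n \<sigma>. 0)"
    using assms by (intro ext) (simp add: cocycles_def coboundary_cup_cochain)
  then show ?thesis
    using assms by (simp add: cocycles_def cup_cochain_in_cochains)
qed

lemma sign_twist_sign_twist: "sign_twist (sign_twist c) = c"
  by (intro ext) (simp add: sign_twist_def flip: mult.assoc power_mult_distrib)

lemma coboundary_sign_twist:
  "coboundary X (sign_twist c) n \<sigma> = - sign_twist (coboundary X c) n \<sigma>"
  by (cases n) (simp_all add: coboundary_def sign_twist_def sum_distrib_left mult_ac sum_negf del: sum.atMost_Suc)

text \<open>
  Changing \<open>c\<close> by \<open>\<delta>b\<close> changes the product with the cocycle \<open>d\<close> by \<open>\<delta>(b \<smile> d)\<close>; changing \<open>d\<close> by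
  \<open>\<delta>b'\<close> changes the product with the cocycle \<open>c'\<close> by \<open>\<delta>(\<plusminus>c' \<smile> b')\<close>.
\<close>

lemma cohomologous_cup_cochain:
  assumes "(c, c') \<in> cohomologous X" "(d, d') \<in> cohomologous X"
  shows "(cup_cochain X c d, cup_cochain X c' d') \<in> cohomologous X"
proof -
  obtain b where b: "c \<in> cocycles X" "c' \<in> cocycles X" "b \<in> cochains X"
      "\<And>n \<sigma>. c n \<sigma> - c' n \<sigma> = coboundary X b n \<sigma>"
    using assms(1) by (rule cohomologousE) blast
  obtain b' where b': "d \<in> cocycles X" "d' \<in> cocycles X" "b' \<in> cochains X"
      "\<And>n \<sigma>. d n \<sigma> - d' n \<sigma> = coboundary X b' n \<sigma>"
    using assms(2) by (rule cohomologousE) blast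
  have \<delta>: "coboundary X d = (\<lambda>n \<sigma>. 0)" "coboundary X (sign_twist c') = (\<lambda>n \<sigma>. 0)"
    using b(2) b'(1) by (auto simp: cocycles_def coboundary_sign_twist fun_eq_iff sign_twist_def)
  have "(cup_cochain X c d, cup_cochain X c' d) \<in> cohomologous X"
  proof (rule cohomologousI)
    show "cup_cochain X c d n \<sigma> - cup_cochain X c' d n \<sigma> = coboundary X (cup_cochain X b d) n \<sigma>" for n \<sigma>
      by (simp add: coboundary_cup_cochain \<delta> b(4) flip: cup_cochain_diff_left)
    show "cup_cochain X b d \<in> cochains X"
      using b(3) b'(1) by (auto simp: cocycles_def intro: cup_cochain_in_cochains)
  qed (use b b' in \<open>auto simp: cup_cochain_in_cocycles\<close>)
  moreover have "(cup_cochain X c' d, cup_cochain X c' d') \<in> cohomologous X"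
  proof (rule cohomologousI)
    show "cup_cochain X c' d n \<sigma> - cup_cochain X c' d' n \<sigma> =
        coboundary X (cup_cochain X (sign_twist c') b') n \<sigma>" for n \<sigma>
      by (simp add: coboundary_cup_cochain \<delta> b'(4) sign_twist_sign_twist flip: cup_cochain_diff_right)
    show "cup_cochain X (sign_twist c') b' \<in> cochains X"
      using b(2) b'(3) by (auto simp: cocycles_def intro: cup_cochain_in_cochains sign_twist_in_cochains)
  qed (use b b' in \<open>auto simp: cup_cochain_in_cocycles\<close>)
  ultimately show ?thesis
    by (rule cohomologous_trans)
qed

lemma cup_class:
  assumes "c \<in> cocycles X" "d \<in> cocycles X"
  shows "cup X (cohomologous X `` {c}) (cohomologous X `` {d}) = cohomologous X `` {cup_cochain X c d}"
proof -
  have "cohomologous X `` {cup_cochain X c' d'} = cohomologous X `` {cup_cochain X c d}"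
    if "(c, c') \<in> cohomologous X" "(d, d') \<in> cohomologous X" for c' d'
    using equiv_class_eq [OF equiv_cohomologous cohomologous_cup_cochain [OF that]] by simp
  moreover have "(c, c) \<in> cohomologous X" "(d, d) \<in> cohomologous X"
    using assms by (simp_all add: cohomologous_refl)
  ultimately show ?thesis
    unfolding cup_def by blast
qed

section \<open>Cocycles that vanish on small simplices\<close>

text \<open>
  The number of subdivisions that makes a simplex small does not have to suffice for its faces,
  because boundaries can cancel. Taking maxima over iterated faces makes the number monotone.
\<close>

primrec face_max :: "(nat \<Rightarrow> ((nat \<Rightarrow> real) \<Rightarrow> 'a) \<Rightarrow> nat) \<Rightarrow> nat \<Rightarrow> ((nat \<Rightarrow> real) \<Rightarrow> 'a) \<Rightarrow> nat" where
  "face_max N 0 \<sigma> = N 0 \<sigma>"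
| "face_max N (Suc n) \<sigma> =
     max (N (Suc n) \<sigma>) (MAX k\<in>{..Suc n}. face_max N n (singular_face (Suc n) k \<sigma>))"

lemma face_max_ge: "N n \<sigma> \<le> face_max N n \<sigma>"
  by (cases n) auto

lemma face_max_face_le:
  assumes "k \<le> Suc n"
  shows "face_max N n (singular_face (Suc n) k \<sigma>) \<le> face_max N (Suc n) \<sigma>"
proof -
  have "face_max N n (singular_face (Suc n) k \<sigma>) \<le> (MAX k\<in>{..Suc n}. face_max N n (singular_face (Suc n) k \<sigma>))"
    using assms by (intro Max_ge) auto
  then show ?thesis
    by simp
qed

lemma singular_chain_subdivision_power:
  "singular_chain p X c \<Longrightarrow> singular_chain p X ((singular_subdivision p ^^ i) c)"
  by (induction i) (auto simp: singular_chain_singular_subdivision)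

lemma chain_boundary_subdivision_power:
  assumes "singular_chain p X c"
  shows "chain_boundary p ((singular_subdivision p ^^ i) c) =
      (singular_subdivision (p - Suc 0) ^^ i) (chain_boundary p c)"
  by (induction i)
    (simp_all add: chain_boundary_singular_subdivision [OF singular_chain_subdivision_power [OF assms]])

text \<open>
  This is the cochain form of the fact that small chains compute homology. Let \<open>h\<close> be the chain
  homotopy between the identity and the barycentric subdivision \<open>sd\<close>. Then
  \<open>D\<^sub>m = h + h sd + \<dots> + h sd\<^bsup>m-1\<^esup>\<close> satisfies \<open>\<partial>D\<^sub>m + D\<^sub>m\<partial> = sd\<^sup>m - id\<close>. Evaluate the cocycle \<open>z\<close> on this
  identity at a simplex \<open>\<sigma>\<close>, with \<open>m\<close> so large that \<open>sd\<^sup>m \<sigma>\<close> is small: the first term vanishes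
  because \<open>z\<close> is a cocycle and the subdivided one because \<open>z\<close> vanishes on small simplices, so
  \<open>z(D\<^sub>m\<partial>\<sigma>) = -z(\<sigma>)\<close>. Since \<open>h\<close> preserves smallness, \<open>z(D\<^sub>m\<tau>)\<close> does not depend on \<open>m\<close> once \<open>m\<close> is
  large, and \<open>\<tau> \<mapsto> -z(D\<^sub>m\<tau>)\<close> is a cochain with coboundary \<open>z\<close>.
\<close>

lemma cocycle_vanishing_on_small_simplices:
  fixes z :: "('a, 'r::comm_ring_1) cochain"
  assumes \<C>: "\<And>U. U \<in> \<C> \<Longrightarrow> openin X U" "topspace X \<subseteq> \<Union>\<C>"
    and z: "z \<in> cocycles X"
    and zero: "\<And>U n \<sigma>. U \<in> \<C> \<Longrightarrow> singular_simplex n (subtopology X U) \<sigma> \<Longrightarrow> z n \<sigma> = 0"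
  shows "(z, \<lambda>n \<sigma>. 0) \<in> cohomologous X"
proof -
  obtain h :: "nat \<Rightarrow> 'a chain \<Rightarrow> 'a chain"
    where h0: "\<And>p. h p 0 = 0"
      and h_diff: "\<And>p a b. h p (a - b) = h p a - h p b"
      and h_chain: "\<And>p Y c. singular_chain p Y c \<Longrightarrow> singular_chain (Suc p) Y (h p c)"
      and h_homotopy: "\<And>p Y c. singular_chain p Y c \<Longrightarrow>
        chain_boundary (Suc p) (h p c) + h (p - Suc 0) (chain_boundary p c) = singular_subdivision p c - c"
    by (rule chain_homotopic_singular_subdivision) blast
  define small where "small p = {f. \<exists>U\<in>\<C>. singular_simplex p (subtopology X U) f}" for p
  have small_eval: "chain_eval (z p) x = 0" if "Poly_Mapping.keys x \<subseteq> small p" for p x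
    using that zero by (intro chain_eval_eq_0) (auto simp: small_def)
  have h_eval: "chain_eval (z (Suc p)) (h p x) = 0" if "Poly_Mapping.keys x \<subseteq> small p" for p x
    using that
  proof (induction rule: frag_induction)
    case (one f)
    then obtain U where "U \<in> \<C>" "singular_simplex p (subtopology X U) f"
      by (auto simp: small_def)
    then have "singular_chain (Suc p) (subtopology X U) (h p (frag_of f))"
      by (simp add: h_chain singular_chain_of)
    then show ?case
      using \<open>U \<in> \<C>\<close> by (intro small_eval) (auto simp: singular_chain_def small_def)
  qed (simp_all add: h0 h_diff chain_eval_diff)
  have "\<exists>n. \<forall>m\<ge>n. Poly_Mapping.keys ((singular_subdivision p ^^ m) (frag_of \<sigma>)) \<subseteq> small p"
    if \<sigma>: "singular_simplex p X \<sigma>" for p \<sigma>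
  proof -
    have ch: "singular_chain p X (frag_of \<sigma>)"
      using \<sigma> by (simp add: singular_chain_of)
    have "\<exists>n. \<forall>m\<ge>n. \<forall>f\<in>Poly_Mapping.keys ((singular_subdivision p ^^ m) (frag_of \<sigma>)).
        \<exists>V\<in>\<C>. f \<in> standard_simplex p \<rightarrow> V"
    proof (rule sufficient_iterated_singular_subdivision_exists [OF \<C> ch])
      fix n
      assume "\<And>m f. n \<le> m \<Longrightarrow> f \<in> Poly_Mapping.keys ((singular_subdivision p ^^ m) (frag_of \<sigma>)) \<Longrightarrow>
        \<exists>V\<in>\<C>. f \<in> standard_simplex p \<rightarrow> V"
      then show ?thesis
        by blast
    qed
    then obtain n where n: "\<And>m f. n \<le> m \<Longrightarrow> f \<in> Poly_Mapping.keys ((singular_subdivision p ^^ m) (frag_of \<sigma>)) \<Longrightarrow>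
        \<exists>V\<in>\<C>. f \<in> standard_simplex p \<rightarrow> V"
      by blast
    have "f \<in> small p"
      if "n \<le> m" "f \<in> Poly_Mapping.keys ((singular_subdivision p ^^ m) (frag_of \<sigma>))" for m f
      using n [OF that] singular_chain_subdivision_power [OF ch, of m] that(2)
      by (auto simp: small_def singular_simplex_subtopology singular_chain_def)
    then show ?thesis
      by blast
  qed
  then obtain N where N: "Poly_Mapping.keys ((singular_subdivision p ^^ m) (frag_of \<sigma>)) \<subseteq> small p"
    if "singular_simplex p X \<sigma>" "N p \<sigma> \<le> m" for p \<sigma> m
    by metis
  define D where "D p m c = (\<Sum>i<m. h p ((singular_subdivision p ^^ i) c))" for p m c
  have D_homotopy: "chain_boundary (Suc p) (D p m c) + D (p - Suc 0) m (chain_boundary p c) =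
      (singular_subdivision p ^^ m) c - c" if "singular_chain p X c" for p m c
  proof (induction m)
    case (Suc m)
    have "chain_boundary (Suc p) (h p ((singular_subdivision p ^^ m) c)) +
        h (p - Suc 0) ((singular_subdivision (p - Suc 0) ^^ m) (chain_boundary p c)) =
        (singular_subdivision p ^^ Suc m) c - (singular_subdivision p ^^ m) c"
      using h_homotopy [OF singular_chain_subdivision_power [OF that, of m]]
      by (simp add: chain_boundary_subdivision_power [OF that])
    with Suc have "(chain_boundary (Suc p) (D p m c) + D (p - Suc 0) m (chain_boundary p c)) +
        (chain_boundary (Suc p) (h p ((singular_subdivision p ^^ m) c)) +
         h (p - Suc 0) ((singular_subdivision (p - Suc 0) ^^ m) (chain_boundary p c))) =
        (singular_subdivision p ^^ Suc m) c - c"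
      by simp
    then show ?case
      by (simp add: D_def chain_boundary_add ac_simps)
  qed (simp add: D_def)
  have D_eval: "chain_eval (z (Suc p)) (D p m x) =
      chain_eval (\<lambda>\<tau>. chain_eval (z (Suc p)) (D p m (frag_of \<tau>))) x" for p m x
    using subset_UNIV [of "Poly_Mapping.keys x"]
    by (induction x rule: frag_induction)
      (simp_all add: D_def h0 h_diff singular_subdivision_power_diff sum_subtractf chain_eval_diff)
  have D_stable: "chain_eval (z (Suc p)) (D p m (frag_of \<tau>)) = chain_eval (z (Suc p)) (D p (face_max N p \<tau>) (frag_of \<tau>))"
    if "singular_simplex p X \<tau>" "face_max N p \<tau> \<le> m" for p m \<tau>
  proof -
    have "chain_eval (z (Suc p)) (h p ((singular_subdivision p ^^ i) (frag_of \<tau>))) = 0"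
      if "face_max N p \<tau> \<le> i" for i
      using that face_max_ge [of N p \<tau>] by (intro h_eval N \<open>singular_simplex p X \<tau>\<close>) simp
    then show ?thesis
      using that(2) unfolding D_def chain_eval_sum by (intro sum.mono_neutral_right) auto
  qed
  define w where "w p \<tau> = (if singular_simplex p X \<tau>
    then - chain_eval (z (Suc p)) (D p (face_max N p \<tau>) (frag_of \<tau>)) else 0)" for p \<tau>
  show ?thesis
  proof (rule cohomologousI [OF z zero_in_cocycles])
    obtain A where "finite A" "\<And>n \<sigma>. n \<notin> A \<Longrightarrow> z n \<sigma> = 0"
      using cocycle_in_cochains [OF z] by (rule cochainsE) blast
    then show "w \<in> cochains X"
      by (intro cochainsI [where A = "Suc -` A"]) (simp_all add: w_def finite_vimageI chain_eval_def)
    fix n \<sigma>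
    show "z n \<sigma> - 0 = coboundary X w n \<sigma>"
    proof (cases "singular_simplex n X \<sigma>")
      case False
      then show ?thesis
        using z by (auto simp: coboundary_def cocycles_def cochains_def)
    next
      case True
      define m where "m = face_max N n \<sigma>"
      have ch: "singular_chain n X (frag_of \<sigma>)"
        using True by (simp add: singular_chain_of)
      have "singular_chain (Suc n) X (D n m (frag_of \<sigma>))"
        unfolding D_def by (intro singular_chain_sum h_chain singular_chain_subdivision_power ch)
      then have "chain_eval (z n) (chain_boundary (Suc n) (D n m (frag_of \<sigma>))) = 0"
        by (rule cocycle_eval_boundary [OF z])
      moreover have "chain_eval (z n) ((singular_subdivision n ^^ m) (frag_of \<sigma>)) = 0"
        unfolding m_def by (intro small_eval N True face_max_ge)
      ultimately have eq: "chain_eval (z n) (D (n - Suc 0) m (chain_boundary n (frag_of \<sigma>))) = - z n \<sigma>"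
        using arg_cong [OF D_homotopy [OF ch, of m], of "chain_eval (z n)"]
        by (simp add: chain_eval_add chain_eval_diff)
      show ?thesis
      proof (cases n)
        case 0
        with eq show ?thesis
          by (simp add: coboundary_def chain_boundary_def D_def h0)
      next
        case (Suc p)
        have face: "singular_simplex p X (singular_face (Suc p) k \<sigma>)" if "k \<le> Suc p" for k
          using singular_simplex_singular_face [of "Suc p" X \<sigma> k] True Suc that by simp
        have step: "chain_eval (z (Suc p)) (D p m (frag_of (singular_face (Suc p) k \<sigma>))) =
            - w p (singular_face (Suc p) k \<sigma>)" if "k \<le> Suc p" for k
          using D_stable [OF face [OF that], of m] face_max_face_le [OF that, of N \<sigma>] face [OF that]
          by (simp add: w_def m_def Suc)
        have "z n \<sigma> = - chain_eval (\<lambda>\<tau>. chain_eval (z (Suc p)) (D p m (frag_of \<tau>))) (chain_boundary (Suc p) (frag_of \<sigma>))"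
          using eq by (simp add: Suc flip: D_eval)
        also have "\<dots> = (\<Sum>k\<le>Suc p. (- 1) ^ k * w p (singular_face (Suc p) k \<sigma>))"
          by (simp add: chain_boundary_of chain_eval_sum chain_eval_cmul step sum_negf del: sum.atMost_Suc)
        finally show ?thesis
          using True by (simp add: coboundary_def Suc del: sum.atMost_Suc)
      qed
    qed
  qed
qed

section \<open>Pullback of cochains and classes\<close>

lemma pullback_in_cochains:
  assumes "c \<in> cochains Y"
  shows "pullback_cochain X f c \<in> cochains X"
proof -
  obtain A where "finite A" "\<And>n \<sigma>. n \<notin> A \<Longrightarrow> c n \<sigma> = 0"
    using assms by (rule cochainsE) blast
  then show ?thesis
    by (intro cochainsI [where A = A]) (auto simp: pullback_cochain_def)
qed

lemma coboundary_pullback: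
  assumes "continuous_map X Y f"
  shows "coboundary X (pullback_cochain X f c) = pullback_cochain X f (coboundary Y c)"
proof (intro ext)
  fix n \<sigma>
  show "coboundary X (pullback_cochain X f c) n \<sigma> = pullback_cochain X f (coboundary Y c) n \<sigma>"
  proof (cases "singular_simplex n X \<sigma> \<and> 1 \<le> n")
    case True
    then have "singular_face n k (simplex_map n f \<sigma>) = simplex_map (n - 1) f (singular_face n k \<sigma>)"
      if "k \<le> n" for k
      using that singular_face_simplex_map [of n k f \<sigma>]
      by (auto simp: simplex_map_def singular_face_def)
    moreover have "singular_simplex (n - 1) X (singular_face n k \<sigma>)" if "k \<le> n" for k
      using True singular_simplex_singular_face [of n X \<sigma> k] that by simp
    ultimately show ?thesis
      using True singular_simplex_simplex_map [OF _ assms, of n \<sigma>]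
      by (simp add: coboundary_def pullback_cochain_def)
  qed (auto simp: coboundary_def pullback_cochain_def)
qed

lemma pullback_in_cocycles:
  "continuous_map X Y f \<Longrightarrow> c \<in> cocycles Y \<Longrightarrow> pullback_cochain X f c \<in> cocycles X"
  by (auto simp: cocycles_def pullback_in_cochains coboundary_pullback pullback_cochain_def fun_eq_iff)

lemma pullback_pullback:
  assumes "continuous_map X Y f"
  shows "pullback_cochain X f (pullback_cochain Y g c) = pullback_cochain X (g \<circ> f) c"
  using singular_simplex_simplex_map [OF _ assms]
  by (auto simp: pullback_cochain_def simplex_map_compose fun_eq_iff)

lemma cohomologous_pullback:
  assumes f: "continuous_map X Y f" and "(c, d) \<in> cohomologous Y"
  shows "(pullback_cochain X f c, pullback_cochain X f d) \<in> cohomologous X"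
proof -
  obtain b where b: "c \<in> cocycles Y" "d \<in> cocycles Y" "b \<in> cochains Y"
      "\<And>n \<sigma>. c n \<sigma> - d n \<sigma> = coboundary Y b n \<sigma>"
    using assms(2) by (rule cohomologousE) blast
  show ?thesis
  proof (rule cohomologousI)
    show "pullback_cochain X f c n \<sigma> - pullback_cochain X f d n \<sigma> = coboundary X (pullback_cochain X f b) n \<sigma>" for n \<sigma>
      using b(4) by (simp add: coboundary_pullback [OF f] pullback_cochain_def)
  qed (use b f in \<open>auto simp: pullback_in_cochains pullback_in_cocycles\<close>)
qed

lemma cohomologous_pullback_zero:
  fixes c :: "('b, 'r::comm_ring_1) cochain"
  assumes "continuous_map X Y f" "(c, \<lambda>n \<sigma>. 0) \<in> cohomologous Y"
  shows "(pullback_cochain X f c, \<lambda>n \<sigma>. 0) \<in> cohomologous X"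
proof -
  have "pullback_cochain X f (\<lambda>n \<sigma>. 0) = (\<lambda>n \<sigma>. 0 :: 'r)"
    by (intro ext) (simp add: pullback_cochain_def)
  then show ?thesis
    using cohomologous_pullback [OF assms] by simp
qed

lemma induced_class_eq_zero_iff:
  assumes f: "continuous_map X Y f" and c: "c \<in> cocycles Y"
  shows "induced X f (cohomologous Y `` {c}) = coh_zero X \<longleftrightarrow>
    (pullback_cochain X f c, \<lambda>n \<sigma>. 0) \<in> cohomologous X"
proof -
  have "(c, c) \<in> cohomologous Y"
    using c by (rule cohomologous_refl)
  moreover have "cohomologous X `` {pullback_cochain X f d} = cohomologous X `` {pullback_cochain X f c}"
    if "(c, d) \<in> cohomologous Y" for d
    using equiv_class_eq [OF equiv_cohomologous cohomologous_pullback [OF f that]] by simp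
  ultimately have "induced X f (cohomologous Y `` {c}) = cohomologous X `` {pullback_cochain X f c}"
    unfolding induced_def by blast
  then show ?thesis
    unfolding coh_zero_def
    using eq_equiv_class_iff [OF equiv_cohomologous pullback_in_cocycles [OF f c] zero_in_cocycles]
    by simp
qed

section \<open>Cup products of classes that vanish on the members of an open cover\<close>

text \<open>
  If a representative restricts to the coboundary of \<open>b\<close> on \<open>V\<close>, subtracting the coboundary of an
  extension of \<open>b\<close> gives a representative that vanishes on all simplices in \<open>V\<close>. This replaces the
  lift of the class to the relative cohomology of the pair \<open>(X, V)\<close>.
\<close>

lemma vanishing_representative:
  fixes u :: "('a, 'r::comm_ring_1) cochain set"
  assumes u: "u \<in> cohomology X"
    and zero: "induced (subtopology X V) (\<lambda>x. x) u = coh_zero (subtopology X V)"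
  obtains c where "c \<in> cocycles X" "u = cohomologous X `` {c}"
    "\<And>n \<sigma>. singular_simplex n (subtopology X V) \<sigma> \<Longrightarrow> c n \<sigma> = 0"
proof -
  let ?V = "subtopology X V"
  obtain d where d: "d \<in> cocycles X" "u = cohomologous X `` {d}"
    using u by (rule cohomology_representative)
  have incl: "continuous_map ?V X (\<lambda>x. x)"
    by (simp add: continuous_map_from_subtopology)
  have "(pullback_cochain ?V (\<lambda>x. x) d, \<lambda>n \<sigma>. 0) \<in> cohomologous ?V"
    using zero d induced_class_eq_zero_iff [OF incl d(1)] by simp
  then obtain b where b: "b \<in> cochains ?V"
      and \<delta>b: "\<And>n \<sigma>. pullback_cochain ?V (\<lambda>x. x) d n \<sigma> = coboundary ?V b n \<sigma>"
    by (rule cohomologousE) simp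
  (* b is zero on simplices outside V, so it is at the same time its own extension to X *)
  have bX: "b \<in> cochains X"
    using b unfolding cochains_def by (auto simp: singular_simplex_subtopology)
  show thesis
  proof
    let ?c = "\<lambda>n \<sigma>. d n \<sigma> - coboundary X b n \<sigma>"
    show c: "?c \<in> cocycles X"
      by (rule diff_in_cocycles [OF d(1) coboundary_in_cocycles [OF bX]])
    have "(d, ?c) \<in> cohomologous X"
      by (rule cohomologousI [OF d(1) c bX]) simp
    then show "u = cohomologous X `` {?c}"
      using d(2) equiv_class_eq [OF equiv_cohomologous] by blast
    fix n \<sigma> assume \<sigma>: "singular_simplex n ?V \<sigma>"
    then have "simplex_map n (\<lambda>x. x) \<sigma> = \<sigma>"
      by (simp add: simplex_map_id_gen)
    then have "d n \<sigma> = coboundary ?V b n \<sigma>"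
      using \<delta>b [of n \<sigma>] \<sigma> by (simp add: pullback_cochain_def)
    also have "\<dots> = coboundary X b n \<sigma>"
      using \<sigma> by (simp add: coboundary_def singular_simplex_subtopology)
    finally show "?c n \<sigma> = 0"
      by simp
  qed
qed

lemma cup_cochain_eq_0:
  assumes \<sigma>: "singular_simplex n (subtopology X V) \<sigma>"
    and "(\<forall>m \<tau>. singular_simplex m (subtopology X V) \<tau> \<longrightarrow> c m \<tau> = 0) \<or>
      (\<forall>m \<tau>. singular_simplex m (subtopology X V) \<tau> \<longrightarrow> d m \<tau> = 0)"
  shows "cup_cochain X c d n \<sigma> = 0"
proof -
  have "c p (front_face p \<sigma>) * d (n - p) (back_face p (n - p) \<sigma>) = 0" if "p \<le> n" for p
    using assms(2) singular_simplex_front_face [OF \<sigma> that] singular_simplex_back_face [of p "n - p" _ \<sigma>] \<sigma> that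
    by auto
  then show ?thesis
    by (simp add: cup_cochain_def)
qed

lemma coh_one_representative:
  fixes X :: "'a topology"
  shows "(\<lambda>n \<sigma>. if n = 0 \<and> singular_simplex 0 X \<sigma> then 1 else 0) \<in> (cocycles X :: ('a, 'r::comm_ring_1) cochain set)"
proof -
  let ?e = "(\<lambda>n \<sigma>. if n = 0 \<and> singular_simplex 0 X \<sigma> then 1 else 0) :: ('a, 'r) cochain"
  have "coboundary X ?e n \<sigma> = 0" for n \<sigma>
    using singular_simplex_singular_face [of 1 X \<sigma>]
    by (cases "n = 1") (auto simp: coboundary_def)
  moreover have "?e \<in> cochains X"
    by (rule cochainsI [where A = "{0}"]) auto
  ultimately show ?thesis
    by (simp add: cocycles_def fun_eq_iff)
qed

text \<open>
  The front and back parts of a simplex in \<open>V i\<close> lie in \<open>V i\<close> again, so the product of cocycles, the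
  \<open>i\<close>-th of which vanishes on \<open>V i\<close>, vanishes on each of these sets.
\<close>

lemma cup_prod_representative:
  fixes u :: "nat \<Rightarrow> ('a, 'r::comm_ring_1) cochain set"
  assumes "\<And>i. i \<in> {1..k} \<Longrightarrow> u i \<in> cohomology X"
    and "\<And>i. i \<in> {1..k} \<Longrightarrow>
      induced (subtopology X (V i)) (\<lambda>x. x) (u i) = coh_zero (subtopology X (V i))"
  shows "\<exists>z\<in>cocycles X. cup_prod X u k = cohomologous X `` {z} \<and>
    (\<forall>i\<in>{1..k}. \<forall>n \<sigma>. singular_simplex n (subtopology X (V i)) \<sigma> \<longrightarrow> z n \<sigma> = 0)"
  using assms
proof (induction k)
  case 0
  then show ?case
    using coh_one_representative by (force simp: coh_one_def)
next
  case (Suc k)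
  then obtain z where z: "z \<in> cocycles X" "cup_prod X u k = cohomologous X `` {z}"
      "\<And>i n \<sigma>. i \<in> {1..k} \<Longrightarrow> singular_simplex n (subtopology X (V i)) \<sigma> \<Longrightarrow> z n \<sigma> = 0"
    by force
  obtain c where c: "c \<in> cocycles X" "u (Suc k) = cohomologous X `` {c}"
      "\<And>n \<sigma>. singular_simplex n (subtopology X (V (Suc k))) \<sigma> \<Longrightarrow> c n \<sigma> = 0"
    using Suc.prems by (auto intro: vanishing_representative [of "u (Suc k)" X "V (Suc k)"])
  show ?case
  proof (intro bexI conjI ballI allI impI)
    show "cup_cochain X z c \<in> cocycles X"
      by (rule cup_cochain_in_cocycles [OF z(1) c(1)])
    show "cup_prod X u (Suc k) = cohomologous X `` {cup_cochain X z c}"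
      using cup_class [OF z(1) c(1)] z(2) c(2) by simp
    fix i n \<sigma> assume i: "i \<in> {1..Suc k}" and \<sigma>: "singular_simplex n (subtopology X (V i)) \<sigma>"
    show "cup_cochain X z c n \<sigma> = 0"
    proof (rule cup_cochain_eq_0 [OF \<sigma>])
      show "(\<forall>m \<tau>. singular_simplex m (subtopology X (V i)) \<tau> \<longrightarrow> z m \<tau> = 0) \<or>
          (\<forall>m \<tau>. singular_simplex m (subtopology X (V i)) \<tau> \<longrightarrow> c m \<tau> = 0)"
        using i z(3) [of i] c(3) by (cases "i = Suc k") auto
    qed
  qed
qed

text \<open>
  The Lusternik-Schnirelmann argument: the product has a representative that vanishes on every
  simplex lying in a member of the open cover.
\<close>

theorem cup_prod_eq_zero_of_open_cover:
  assumes "\<And>i. i \<in> {1..k} \<Longrightarrow> openin X (V i)" "(\<Union>i\<in>{1..k}. V i) = topspace X"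
    and "\<And>i. i \<in> {1..k} \<Longrightarrow> u i \<in> cohomology X"
    and "\<And>i. i \<in> {1..k} \<Longrightarrow>
      induced (subtopology X (V i)) (\<lambda>x. x) (u i) = coh_zero (subtopology X (V i))"
  shows "cup_prod X u k = coh_zero X"
proof -
  obtain z where z: "z \<in> cocycles X" "cup_prod X u k = cohomologous X `` {z}"
      "\<And>i n \<sigma>. i \<in> {1..k} \<Longrightarrow> singular_simplex n (subtopology X (V i)) \<sigma> \<Longrightarrow> z n \<sigma> = 0"
    using cup_prod_representative [of k u X V] assms(3,4) by blast
  have "(z, \<lambda>n \<sigma>. 0) \<in> cohomologous X"
    by (rule cocycle_vanishing_on_small_simplices [where \<C> = "V ` {1..k}"]) (use assms(1,2) z in auto)
  then show ?thesis
    using z(2) coh_zero_eq_class by blast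
qed

section \<open>Homotopy invariance of cohomology\<close>

lemma chain_map_comp: "chain_map n (g \<circ> f) c = chain_map n g (chain_map n f c)"
  by (simp add: chain_map_compose)

text \<open>
  A contraction deforms a cycle to its image under a constant map. This image bounds within the
  point if the degree is positive; in degree \<open>0\<close> its vanishing is an assumption.
\<close>

lemma cycle_in_contractible_space_bounds:
  fixes W :: "'a topology"
  assumes W: "contractible_space W" and z: "singular_chain p W z" "chain_boundary p z = 0"
    and const: "p = 0 \<Longrightarrow> (\<And>a :: 'a. chain_map p (\<lambda>x. a) z = 0)"
  obtains y where "singular_chain (Suc p) W y" "chain_boundary (Suc p) y = z"
proof (cases "topspace W = {}")
  case True
  then have "z = 0"
    using z singular_chain_empty by blast
  then show ?thesis
    using that [of 0] by simp
next
  case False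
  obtain a where hom: "homotopic_with (\<lambda>x. True) W W id (\<lambda>x. a)"
    using W unfolding contractible_space_def by blast
  then have "a \<in> topspace W"
    using False homotopic_with_imp_continuous_maps [OF hom] by (auto simp: continuous_map_const)
  then have pt: "topspace (subtopology W {a}) = {a}"
    by auto
  have "singular_relcycle p W {} z"
    using z by (simp add: singular_cycle)
  moreover have "homotopic_with (\<lambda>h. h \<in> {} \<rightarrow> {}) W W id (\<lambda>x. a)"
    using hom by (rule homotopic_with_mono) simp
  ultimately have "homologous_rel p W {} (chain_map p id z) (chain_map p (\<lambda>x. a) z)"
    using homotopic_imp_homologous_rel_chain_maps by blast
  then obtain y1 where y1: "singular_chain (Suc p) W y1" "chain_boundary (Suc p) y1 = z - chain_map p (\<lambda>x. a) z"
    unfolding homologous_rel_def singular_boundary chain_map_ident [OF z(1)] by blast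
  have "\<exists>y2. singular_chain (Suc p) W y2 \<and> chain_boundary (Suc p) y2 = chain_map p (\<lambda>x. a) z"
  proof (cases "p = 0")
    case True
    then show ?thesis
      using const by (intro exI [of _ 0]) simp
  next
    case False
    have "continuous_map W (subtopology W {a}) (\<lambda>x. a)"
      using pt by (simp add: continuous_map_const)
    then have "singular_relcycle p (subtopology W {a}) {} (chain_map p (\<lambda>x. a) z)"
      using z by (simp add: singular_cycle chain_boundary_chain_map singular_chain_chain_map)
    then have "singular_relboundary p (subtopology W {a}) {} (chain_map p (\<lambda>x. a) z)"
      using False by (simp add: singular_boundary_eq_cycle_singleton [OF pt])
    then show ?thesis
      unfolding singular_boundary by (meson singular_chain_subtopology)
  qed
  then obtain y2 where "singular_chain (Suc p) W y2" "chain_boundary (Suc p) y2 = chain_map p (\<lambda>x. a) z"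
    by blast
  then show ?thesis
    using y1 that [of "y1 + y2"] by (simp add: singular_chain_add chain_boundary_add)
qed

abbreviation simplex_space :: "nat \<Rightarrow> (nat \<Rightarrow> real) topology" where
  "simplex_space n \<equiv> subtopology (powertop_real UNIV) (standard_simplex n)"

abbreviation cylinder :: "'a topology \<Rightarrow> (real \<times> 'a) topology" where
  "cylinder X \<equiv> prod_topology (top_of_set {0..1}) X"

abbreviation identity_simplex :: "nat \<Rightarrow> (nat \<Rightarrow> real) chain" where
  "identity_simplex n \<equiv> frag_of (restrict id (standard_simplex n))"

lemma contractible_simplex_space: "contractible_space (simplex_space n)"
proof -
  define a :: "nat \<Rightarrow> real" where "a = (\<lambda>j. if j = 0 then 1 else 0)"
  define h where "h = (\<lambda>(s, x) i. (1 - s) * x i + s * a i :: real)"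
  have a: "a \<in> standard_simplex n"
    by (simp add: a_def)
  have "continuous_map (prod_topology (top_of_set {0..1}) (simplex_space n)) (simplex_space n) h"
    unfolding continuous_map_in_subtopology
  proof
    have fst: "continuous_map (prod_topology (top_of_set {0..1}) (simplex_space n)) euclideanreal fst"
      using continuous_map_fst continuous_map_into_fulltopology by blast
    have snd: "continuous_map (prod_topology (top_of_set {0..1}) (simplex_space n)) euclideanreal (\<lambda>z. snd z i)" for i
    proof -
      have "continuous_map (simplex_space n) euclideanreal (\<lambda>x. x i)"
        by (auto intro: continuous_map_product_projection continuous_map_from_subtopology)
      then show ?thesis
        using continuous_map_compose [OF continuous_map_snd] by (force simp: o_def)
    qed
    show "continuous_map (prod_topology (top_of_set {0..1}) (simplex_space n)) (powertop_real UNIV) h"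
      unfolding continuous_map_componentwise_UNIV h_def case_prod_unfold
      by (intro allI continuous_map_add continuous_map_real_mult continuous_map_diff fst snd) auto
    show "h \<in> topspace (prod_topology (top_of_set {0..1}) (simplex_space n)) \<rightarrow> standard_simplex n"
      using convex_standard_simplex [OF _ a] by (auto simp: h_def)
  qed
  then have "homotopic_with (\<lambda>x. True) (simplex_space n) (simplex_space n) id (\<lambda>x. a)"
    unfolding homotopic_with_def by (intro exI [of _ h]) (auto simp: h_def)
  then show ?thesis
    unfolding contractible_space_def by blast
qed

lemma contractible_cylinder_simplex_space: "contractible_space (cylinder (simplex_space n))"
  by (simp add: contractible_space_prod_topology contractible_simplex_space is_interval_1 convex_imp_contractible)

text \<open>
  A chain \<open>x\<close> of dimension \<open>n + 1\<close> in the cylinder on the standard \<open>n\<close>-simplex is a model of a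
  prism: transporting it along each simplex of a chain gives a natural map from \<open>n\<close>-chains of a
  space to \<open>(n + 1)\<close>-chains of its cylinder.
\<close>

definition prism :: "nat \<Rightarrow> (real \<times> (nat \<Rightarrow> real)) chain \<Rightarrow> 'a chain \<Rightarrow> (real \<times> 'a) chain" where
  "prism n x = frag_extend (\<lambda>\<sigma>. chain_map (Suc n) (apsnd \<sigma>) x)"

lemma prism_0 [simp]: "prism n x 0 = 0"
  by (simp add: prism_def)

lemma prism_diff: "prism n x (a - b) = prism n x a - prism n x b"
  by (simp add: prism_def frag_extend_diff)

lemma continuous_map_apsnd:
  "continuous_map X Y f \<Longrightarrow> continuous_map (cylinder X) (cylinder Y) (apsnd f)"
  unfolding apsnd_def map_prod_def id_def
  by (simp add: continuous_map_prod_top)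

lemma continuous_map_Pair_cylinder:
  "t \<in> {0..1} \<Longrightarrow> continuous_map X (cylinder X) (Pair t)"
  by (simp add: continuous_map_pairwise o_def)

lemma singular_chain_prism:
  assumes "singular_chain (Suc n) (cylinder (simplex_space n)) x" "singular_chain n Y c"
  shows "singular_chain (Suc n) (cylinder Y) (prism n x c)"
  unfolding prism_def
proof (rule singular_chain_extend)
  fix \<sigma> assume "\<sigma> \<in> Poly_Mapping.keys c"
  then have "continuous_map (simplex_space n) Y \<sigma>"
    using assms(2) by (auto simp: singular_chain_def singular_simplex_def)
  then show "singular_chain (Suc n) (cylinder Y) (chain_map (Suc n) (apsnd \<sigma>) x)"
    using assms(1) continuous_map_apsnd singular_chain_chain_map by blast
qed

lemma prism_chain_map:
  assumes "singular_chain (Suc n) (cylinder (simplex_space n)) x"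
  shows "prism n x (chain_map n f c) = chain_map (Suc n) (apsnd f) (prism n x c)"
  using subset_UNIV [of "Poly_Mapping.keys c"]
proof (induction c rule: frag_induction)
  case (one \<sigma>)
  have "chain_map (Suc n) (apsnd (simplex_map n f \<sigma>)) x = chain_map (Suc n) (apsnd f \<circ> apsnd \<sigma>) x"
    by (rule chain_map_eq [OF assms]) (auto simp: simplex_map_def)
  then show ?case
    by (simp add: prism_def chain_map_compose)
qed (simp_all add: chain_map_diff prism_diff)

text \<open>
  By naturality, the formula for the boundary of a prism holds for all chains of all spaces as soon
  as it holds for the identity of the standard simplex.
\<close>

lemma chain_boundary_prism:
  fixes c :: "'a chain"
  assumes x: "0 < n \<Longrightarrow> singular_chain (Suc (n - 1)) (cylinder (simplex_space (n - 1))) x"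
    and y: "singular_chain (Suc n) (cylinder (simplex_space n)) y"
    and bdy: "chain_boundary (Suc n) y =
      chain_map n (Pair 1) (identity_simplex n) - chain_map n (Pair 0) (identity_simplex n) -
      prism (n - 1) x (chain_boundary n (identity_simplex n))"
    and c: "singular_chain n Y c"
  shows "chain_boundary (Suc n) (prism n y c) =
    chain_map n (Pair 1) c - chain_map n (Pair 0) c - prism (n - 1) x (chain_boundary n c)"
  using c unfolding singular_chain_def
proof (induction rule: frag_induction)
  case (one \<sigma>)
  then have \<sigma>: "singular_simplex n Y \<sigma>"
    by simp
  let ?\<iota> = "identity_simplex n"
  have \<iota>: "singular_chain n (simplex_space n) ?\<iota>"
    by (simp add: singular_chain_of simplicial_imp_singular_simplex)
  have id: "chain_map n \<sigma> ?\<iota> = frag_of \<sigma>"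
    using singular_simplex_chain_map_id [OF \<sigma>] .
  have nat: "chain_map n (apsnd \<sigma>) (prism (n - 1) x (chain_boundary n ?\<iota>)) =
      prism (n - 1) x (chain_boundary n (frag_of \<sigma>))"
  proof (cases n)
    case 0
    then show ?thesis
      by (simp add: chain_boundary_def)
  next
    case (Suc m)
    then show ?thesis
      using chain_boundary_chain_map [OF \<iota>, of \<sigma>] prism_chain_map [OF x, of \<sigma> "chain_boundary n ?\<iota>"]
      unfolding id by simp
  qed
  have "chain_boundary (Suc n) (prism n y (frag_of \<sigma>)) =
      chain_map n (apsnd \<sigma>) (chain_boundary (Suc n) y)"
    using chain_boundary_chain_map [OF y] by (simp add: prism_def)
  also have "\<dots> = chain_map n (apsnd \<sigma> \<circ> Pair 1) ?\<iota> - chain_map n (apsnd \<sigma> \<circ> Pair 0) ?\<iota> -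
      chain_map n (apsnd \<sigma>) (prism (n - 1) x (chain_boundary n ?\<iota>))"
    unfolding bdy chain_map_diff chain_map_comp ..
  also have "apsnd \<sigma> \<circ> Pair 1 = Pair (1::real) \<circ> \<sigma>"
    by auto
  also have "apsnd \<sigma> \<circ> Pair 0 = Pair (0::real) \<circ> \<sigma>"
    by auto
  finally show ?case
    unfolding chain_map_comp id nat .
next
  case (diff a b)
  then show ?case
    by (simp add: chain_map_diff prism_diff chain_boundary_diff)
qed simp

text \<open>
  The method of acyclic models: the boundary prescribed for the next model is a cycle, because the
  boundary formula for the preceding model applies to the boundary of the standard simplex, and it
  bounds because the cylinder on the standard simplex is contractible.
\<close>

lemma prism_models:
  obtains P where "\<And>n. singular_chain (Suc n) (cylinder (simplex_space n)) (P n)"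
    "\<And>n. chain_boundary (Suc n) (P n) =
      chain_map n (Pair 1) (identity_simplex n) - chain_map n (Pair 0) (identity_simplex n) -
      prism (n - 1) (P (n - 1)) (chain_boundary n (identity_simplex n))"
proof -
  let ?\<iota> = identity_simplex
  define ends :: "nat \<Rightarrow> (nat \<Rightarrow> real) chain \<Rightarrow> (real \<times> (nat \<Rightarrow> real)) chain"
    where "ends n c = chain_map n (Pair 1) c - chain_map n (Pair 0) c" for n c
  (* The next model needs the boundary formula only for the boundary of the standard simplex, so it
     suffices to keep track of cycles; degree 0 records the formula for the identity simplex too. *)
  define good where "good n x \<longleftrightarrow> singular_chain (Suc n) (cylinder (simplex_space n)) x \<and>
    (n = 0 \<longrightarrow> chain_boundary (Suc n) x = ends n (?\<iota> n)) \<and>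
    (\<forall>Y c. singular_chain n Y c \<longrightarrow> chain_boundary n c = 0 \<longrightarrow>
      chain_boundary (Suc n) (prism n x c) = ends n c)" for n x
  have \<iota>: "singular_chain n (simplex_space n) (?\<iota> n)" for n
    by (simp add: singular_chain_of simplicial_imp_singular_simplex)
  have ends_chain: "singular_chain n (cylinder (simplex_space n)) (ends n (?\<iota> n))" for n
    unfolding ends_def
    by (intro singular_chain_diff singular_chain_chain_map [OF \<iota>] continuous_map_Pair_cylinder) auto
  have "\<exists>P. \<forall>n. good n (P n) \<and> chain_boundary (Suc (Suc n)) (P (Suc n)) =
      ends (Suc n) (?\<iota> (Suc n)) - prism n (P n) (chain_boundary (Suc n) (?\<iota> (Suc n)))"
  proof (rule dependent_nat_choice)
    have "chain_map 0 (\<lambda>x. a) (ends 0 (?\<iota> 0)) = 0" for a :: "real \<times> (nat \<Rightarrow> real)"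
      by (simp add: ends_def chain_map_diff simplex_map_def o_def restrict_def)
    moreover have "chain_boundary 0 (ends 0 (?\<iota> 0)) = 0"
      by (simp add: chain_boundary_def)
    ultimately obtain y where "singular_chain (Suc 0) (cylinder (simplex_space 0)) y"
        "chain_boundary (Suc 0) y = ends 0 (?\<iota> 0)"
      using cycle_in_contractible_space_bounds [OF contractible_cylinder_simplex_space ends_chain [of 0]]
      by blast
    then have "good 0 y"
      using chain_boundary_prism [of 0 0 y, where 'a = "nat \<Rightarrow> real"] by (auto simp: good_def ends_def chain_boundary_def)
    then show "\<exists>x. good 0 x" ..
  next
    fix x n assume "good n x"
    then have x: "singular_chain (Suc n) (cylinder (simplex_space n)) x"
      and prism: "\<And>Y c. singular_chain n Y c \<Longrightarrow> chain_boundary n c = 0 \<Longrightarrow>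
        chain_boundary (Suc n) (prism n x c) = ends n c"
      by (auto simp: good_def)
    let ?bd\<iota> = "chain_boundary (Suc n) (?\<iota> (Suc n))"
    have bd\<iota>: "singular_chain n (simplex_space (Suc n)) ?bd\<iota>" "chain_boundary n ?bd\<iota> = 0"
      using singular_chain_boundary [OF \<iota> [of "Suc n"]] chain_boundary_boundary [OF \<iota> [of "Suc n"]] by auto
    have "chain_boundary (Suc n) (ends (Suc n) (?\<iota> (Suc n))) = ends n ?bd\<iota>"
      using chain_boundary_chain_map [OF \<iota> [of "Suc n"], of "Pair (0::real)"]
        chain_boundary_chain_map [OF \<iota> [of "Suc n"], of "Pair (1::real)"]
      by (simp add: ends_def chain_boundary_diff)
    then have "chain_boundary (Suc n) (ends (Suc n) (?\<iota> (Suc n)) - prism n x ?bd\<iota>) = 0"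
      using prism [OF bd\<iota>] by (simp add: chain_boundary_diff)
    moreover have "singular_chain (Suc n) (cylinder (simplex_space (Suc n))) (ends (Suc n) (?\<iota> (Suc n)) - prism n x ?bd\<iota>)"
      by (intro singular_chain_diff ends_chain singular_chain_prism [OF x] bd\<iota>(1))
    ultimately obtain y where y: "singular_chain (Suc (Suc n)) (cylinder (simplex_space (Suc n))) y"
        "chain_boundary (Suc (Suc n)) y = ends (Suc n) (?\<iota> (Suc n)) - prism n x ?bd\<iota>"
      using cycle_in_contractible_space_bounds [OF contractible_cylinder_simplex_space] by blast
    have "good (Suc n) y"
      using y chain_boundary_prism [of "Suc n" x y, where 'a = "nat \<Rightarrow> real"] x by (auto simp: good_def ends_def)
    with y(2) show "\<exists>y. good (Suc n) y \<and> chain_boundary (Suc (Suc n)) y =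
        ends (Suc n) (?\<iota> (Suc n)) - prism n x ?bd\<iota>"
      by blast
  qed
  then obtain P where P: "\<And>n. good n (P n)"
      "\<And>n. chain_boundary (Suc (Suc n)) (P (Suc n)) =
        ends (Suc n) (?\<iota> (Suc n)) - prism n (P n) (chain_boundary (Suc n) (?\<iota> (Suc n)))"
    by blast
  show thesis
  proof
    show "singular_chain (Suc n) (cylinder (simplex_space n)) (P n)" for n
      using P(1) by (simp add: good_def)
    show "chain_boundary (Suc n) (P n) = chain_map n (Pair 1) (?\<iota> n) - chain_map n (Pair 0) (?\<iota> n) -
        prism (n - 1) (P (n - 1)) (chain_boundary n (?\<iota> n))" for n
      using P(1) [of 0] P(2)
      by (cases n) (simp_all add: good_def ends_def chain_boundary_def [of 0])
  qed
qed

text \<open>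
  The homotopy pushes the prisms over the simplices of \<open>X\<close> into \<open>Y\<close>. The resulting operator \<open>D\<close> is a
  chain homotopy between the two chain maps, and the cochain \<open>\<tau> \<mapsto> c(D \<tau>)\<close> has the difference of the
  two pullbacks as its coboundary.
\<close>

theorem homotopic_imp_cohomologous_pullback:
  assumes hom: "homotopic_with (\<lambda>h. True) X Y f g" and c: "c \<in> cocycles Y"
  shows "(pullback_cochain X g c, pullback_cochain X f c) \<in> cohomologous X"
proof -
  obtain H where H: "continuous_map (cylinder X) Y H"
    and H0: "H \<circ> Pair 0 = f" and H1: "H \<circ> Pair 1 = g"
    using hom by (auto simp: homotopic_with_def o_def)
  obtain P where P: "\<And>n. singular_chain (Suc n) (cylinder (simplex_space n)) (P n)"
    and bdP: "\<And>n. chain_boundary (Suc n) (P n) =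
      chain_map n (Pair 1) (identity_simplex n) - chain_map n (Pair 0) (identity_simplex n) -
      prism (n - 1) (P (n - 1)) (chain_boundary n (identity_simplex n))"
    by (rule prism_models) blast
  define D where "D n x = chain_map (Suc n) H (prism n (P n) x)" for n x
  have D_chain: "singular_chain (Suc n) Y (D n x)" if "singular_chain n X x" for n x
    unfolding D_def by (intro singular_chain_chain_map [OF _ H] singular_chain_prism P that)
  have bdD: "chain_boundary (Suc n) (D n x) =
      chain_map n g x - chain_map n f x - chain_map n H (prism (n - 1) (P (n - 1)) (chain_boundary n x))"
    if x: "singular_chain n X x" for n x
  proof -
    have "chain_boundary (Suc n) (D n x) = chain_map n H (chain_boundary (Suc n) (prism n (P n) x))"
      using chain_boundary_chain_map [OF singular_chain_prism [OF P x], of H] by (simp add: D_def)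
    also have "\<dots> = chain_map n H (chain_map n (Pair 1) x) - chain_map n H (chain_map n (Pair 0) x) -
        chain_map n H (prism (n - 1) (P (n - 1)) (chain_boundary n x))"
      using chain_boundary_prism [OF P P bdP x] by (simp add: chain_map_diff)
    finally show ?thesis
      unfolding H0 [symmetric] H1 [symmetric] chain_map_comp .
  qed
  have D_eval: "chain_eval e (D n x) = chain_eval (\<lambda>\<tau>. chain_eval e (D n (frag_of \<tau>))) x"
    for e :: "_ \<Rightarrow> 'c" and n x
    using subset_UNIV [of "Poly_Mapping.keys x"]
    by (induction x rule: frag_induction) (simp_all add: D_def prism_diff chain_map_diff chain_eval_diff)
  define w where "w n \<tau> = (if singular_simplex n X \<tau> then chain_eval (c (Suc n)) (D n (frag_of \<tau>)) else 0)" for n \<tau>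
  have X: "continuous_map X Y f" "continuous_map X Y g"
    using homotopic_with_imp_continuous_maps [OF hom] by auto
  show ?thesis
  proof (rule cohomologousI [OF pullback_in_cocycles [OF X(2) c] pullback_in_cocycles [OF X(1) c]])
    obtain A where "finite A" "\<And>n \<sigma>. n \<notin> A \<Longrightarrow> c n \<sigma> = 0"
      using cocycle_in_cochains [OF c] by (rule cochainsE) blast
    then show "w \<in> cochains X"
      by (intro cochainsI [where A = "Suc -` A"]) (simp_all add: w_def finite_vimageI chain_eval_def)
    fix n \<sigma>
    show "pullback_cochain X g c n \<sigma> - pullback_cochain X f c n \<sigma> = coboundary X w n \<sigma>"
    proof (cases "singular_simplex n X \<sigma>")
      case False
      then show ?thesis
        by (simp add: pullback_cochain_def coboundary_def)
    next
      case True
      then have ch: "singular_chain n X (frag_of \<sigma>)"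
        by (simp add: singular_chain_of)
      have "chain_eval (c n) (chain_boundary (Suc n) (D n (frag_of \<sigma>))) = 0"
        by (rule cocycle_eval_boundary [OF c D_chain [OF ch]])
      then have eq: "pullback_cochain X g c n \<sigma> - pullback_cochain X f c n \<sigma> =
          chain_eval (c n) (chain_map n H (prism (n - 1) (P (n - 1)) (chain_boundary n (frag_of \<sigma>))))"
        using True by (simp add: bdD [OF ch] chain_eval_diff pullback_cochain_def)
      show ?thesis
      proof (cases n)
        case 0
        with eq show ?thesis
          by (simp add: coboundary_def chain_boundary_def)
      next
        case (Suc m)
        have face: "singular_simplex m X (singular_face (Suc m) k \<sigma>)" if "k \<le> Suc m" for k
          using singular_simplex_singular_face [of "Suc m" X \<sigma> k] True Suc that by simp
        have "chain_eval (c n) (D m (chain_boundary (Suc m) (frag_of \<sigma>))) =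
            (\<Sum>k\<le>Suc m. (- 1) ^ k * w m (singular_face (Suc m) k \<sigma>))"
          using face
          by (subst D_eval) (simp add: chain_boundary_of chain_eval_sum chain_eval_cmul w_def Suc del: sum.atMost_Suc)
        with eq True show ?thesis
          by (simp add: coboundary_def D_def Suc del: sum.atMost_Suc)
      qed
    qed
  qed
qed

section \<open>Maps and homotopies between homotopy orbit spaces\<close>

lemma left_G_space_subtopology:
  assumes "left_G_space X \<alpha>" "\<And>g x. x \<in> U \<Longrightarrow> \<alpha> g x \<in> U"
  shows "left_G_space (subtopology X U) \<alpha>"
proof -
  have cont: "continuous_map (prod_topology euclidean X) X (\<lambda>(g, x). \<alpha> g x)"
    using assms(1) by (simp add: left_G_space_def)
  have "continuous_map (prod_topology euclidean (subtopology X U)) (subtopology X U) (\<lambda>(g, x). \<alpha> g x)"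
    unfolding continuous_map_in_subtopology prod_topology_subtopology(2)
    using cont assms(2) by (auto intro: continuous_map_from_subtopology)
  then show ?thesis
    using assms(1) by (simp add: left_G_space_def)
qed

lemma homotopy_orbit_quotient_map:
  "quotient_map (prod_topology P X) (homotopy_orbit_space P \<rho> X \<alpha>) (\<lambda>z. homotopy_orbit_rel P \<rho> X \<alpha> `` {z})"
  unfolding homotopy_orbit_space_def by (rule quotient_map_quotient_topology)

lemma homotopy_orbit_map_compose: "homotopy_orbit_map (g \<circ> f) = homotopy_orbit_map g \<circ> homotopy_orbit_map f"
  by (rule ext) (force simp: homotopy_orbit_map_def image_image)

lemma homotopy_orbit_map_ident: "homotopy_orbit_map (\<lambda>x. x) = (\<lambda>c. c)"
  by (rule ext) (simp add: homotopy_orbit_map_def)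

text \<open>
  The stages of an equivariant homotopy induce maps of the homotopy orbit spaces. Joint continuity
  in the time parameter holds because the product of a quotient map with the identity of the
  compact interval is again a quotient map.
\<close>

lemma homotopic_homotopy_orbit_map:
  fixes P :: "'p topology" and X :: "'a topology" and Y :: "'b topology"
  assumes P: "right_G_space P \<rho>" and X: "left_G_space X \<alpha>" and Y: "left_G_space Y \<beta>"
    and hom: "G_homotopic X \<alpha> Y \<beta> f f'"
  shows "homotopic_with (\<lambda>h. True) (homotopy_orbit_space P \<rho> X \<alpha>) (homotopy_orbit_space P \<rho> Y \<beta>)
    (homotopy_orbit_map f) (homotopy_orbit_map f')"
proof -
  let ?X = "homotopy_orbit_space P \<rho> X \<alpha>" and ?Y = "homotopy_orbit_space P \<rho> Y \<beta>"
  let ?q = "\<lambda>z. homotopy_orbit_rel P \<rho> X \<alpha> `` {z}" and ?r = "\<lambda>z. homotopy_orbit_rel P \<rho> Y \<beta> `` {z}"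
  obtain H where H: "continuous_map (cylinder X) Y H"
    and H0: "\<And>x. H (0, x) = f x" and H1: "\<And>x. H (1, x) = f' x"
    and equiv: "\<And>t. t \<in> {0..1} \<Longrightarrow> equivariant_on (topspace X) \<alpha> \<beta> (\<lambda>x. H (t, x))"
    using hom by (auto simp: G_homotopic_def homotopic_with_def)
  define K :: "real \<times> ('p \<times> 'a) set \<Rightarrow> ('p \<times> 'b) set" where "K = (\<lambda>(t, c). homotopy_orbit_map (\<lambda>x. H (t, x)) c)"
  have stage: "G_map X \<alpha> Y \<beta> (\<lambda>x. H (t, x))" if "t \<in> {0..1}" for t
    using continuous_map_compose [OF continuous_map_Pair_cylinder [OF that] H] equiv [OF that]
    by (simp add: G_map_def o_def)
  have K: "K (t, ?q (e, x)) = ?r (e, H (t, x))" if "t \<in> {0..1}" "e \<in> topspace P" "x \<in> topspace X" for t e x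
    using homotopy_orbit_map_class [OF P X Y stage [OF that(1)] that(2,3)] by (simp add: K_def)
  have quot: "quotient_map (cylinder (prod_topology P X)) (cylinder ?X) (\<lambda>(t, z). (t, ?q z))"
    by (rule quotient_map_prod_right [OF _ _ homotopy_orbit_quotient_map])
      (auto simp: compact_imp_locally_compact_space compact_space_subtopology Hausdorff_space_subtopology)
  have "continuous_map (cylinder (prod_topology P X)) (prod_topology P Y) (\<lambda>(t, e, x). (e, H (t, x)))"
  proof -
    have "continuous_map (cylinder (prod_topology P X)) P (\<lambda>z. fst (snd z))"
      using continuous_map_compose [OF continuous_map_snd continuous_map_fst] by (simp add: o_def)
    moreover have "continuous_map (cylinder (prod_topology P X)) (cylinder X) (\<lambda>z. (fst z, snd (snd z)))"
    proof -
      have "continuous_map (cylinder (prod_topology P X)) X (\<lambda>z. snd (snd z))"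
        using continuous_map_compose [OF continuous_map_snd continuous_map_snd] by (simp add: o_def)
      then show ?thesis
        using continuous_map_fst by (simp add: continuous_map_pairwise o_def)
    qed
    then have "continuous_map (cylinder (prod_topology P X)) Y (\<lambda>z. H (fst z, snd (snd z)))"
      using continuous_map_compose [OF _ H] by (fastforce simp: o_def)
    ultimately show ?thesis
      by (simp add: continuous_map_pairwise o_def case_prod_unfold)
  qed
  then have "continuous_map (cylinder (prod_topology P X)) ?Y (?r \<circ> (\<lambda>(t, e, x). (e, H (t, x))))"
    by (rule continuous_map_compose) (rule quotient_imp_continuous_map [OF homotopy_orbit_quotient_map])
  then have "continuous_map (cylinder (prod_topology P X)) ?Y (K \<circ> (\<lambda>(t, z). (t, ?q z)))"
    by (rule continuous_map_eq) (auto simp: K)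
  then have "continuous_map (cylinder ?X) ?Y K"
    by (rule continuous_compose_quotient_map [OF quot])
  then show ?thesis
    unfolding homotopic_with_def by (intro exI [of _ K]) (auto simp: K_def H0 H1)
qed

lemma continuous_homotopy_orbit_map:
  assumes "right_G_space P \<rho>" "left_G_space X \<alpha>" "left_G_space Y \<beta>" "G_map X \<alpha> Y \<beta> f"
  shows "continuous_map (homotopy_orbit_space P \<rho> X \<alpha>) (homotopy_orbit_space P \<rho> Y \<beta>) (homotopy_orbit_map f)"
proof -
  have "G_homotopic X \<alpha> Y \<beta> f f"
    using assms(4) by (simp add: G_homotopic_def G_map_def)
  then show ?thesis
    using homotopic_homotopy_orbit_map [OF assms(1-3)] homotopic_with_imp_continuous_maps by blast
qed

lemma openin_quotient_map_iff:
  assumes "quotient_map X Y f"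
  shows "openin Y W \<longleftrightarrow> W \<subseteq> f ` topspace X \<and> openin X {x \<in> topspace X. f x \<in> W}"
  using assms openin_subset [of Y W] unfolding quotient_map_def by blast

text \<open>
  An invariant open set \<open>U\<close> gives a saturated open subset of \<open>P \<times> X\<close>, and quotient maps restrict to
  such subsets. As sets of pairs, the classes over \<open>U\<close> are the same for \<open>U\<close> and for \<open>X\<close>.
\<close>

lemma homotopy_orbit_space_open_subset:
  assumes P: "right_G_space P \<rho>" and X: "left_G_space X \<alpha>"
    and U: "openin X U" "\<And>g x. x \<in> U \<Longrightarrow> \<alpha> g x \<in> U"
  defines "V \<equiv> (\<lambda>z. homotopy_orbit_rel P \<rho> X \<alpha> `` {z}) ` (topspace P \<times> U)"
  shows "openin (homotopy_orbit_space P \<rho> X \<alpha>) V"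
    and "homotopy_orbit_space P \<rho> (subtopology X U) \<alpha> = subtopology (homotopy_orbit_space P \<rho> X \<alpha>) V"
proof -
  let ?X = "homotopy_orbit_space P \<rho> X \<alpha>"
  let ?R = "homotopy_orbit_rel P \<rho> X \<alpha>" and ?S = "homotopy_orbit_rel P \<rho> (subtopology X U) \<alpha>"
  have UX: "U \<subseteq> topspace X"
    using U(1) by (rule openin_subset)
  have quot: "quotient_map (prod_topology P X) ?X (\<lambda>z. ?R `` {z})"
    by (rule homotopy_orbit_quotient_map)
  have sat: "{z \<in> topspace (prod_topology P X). ?R `` {z} \<in> V} = topspace P \<times> U"
  proof (intro equalityI subsetI)
    fix z assume z: "z \<in> {z \<in> topspace (prod_topology P X). ?R `` {z} \<in> V}"
    then obtain w where w: "w \<in> topspace P \<times> U" and "?R `` {z} = ?R `` {w}"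
      unfolding V_def by blast
    moreover have "z \<in> ?R `` {z}"
      using z by (intro equiv_class_self [OF equiv_homotopy_orbit_rel [OF P X]]) simp
    ultimately have "(w, z) \<in> ?R"
      by simp
    then show "z \<in> topspace P \<times> U"
      using w U(2) by (auto simp: homotopy_orbit_rel_def)
  next
    fix z assume "z \<in> topspace P \<times> U"
    then show "z \<in> {z \<in> topspace (prod_topology P X). ?R `` {z} \<in> V}"
      using UX unfolding V_def by auto
  qed
  have "openin (prod_topology P X) (topspace P \<times> U)"
    using U(1) by (simp add: openin_prod_Times_iff)
  moreover have "V \<subseteq> (\<lambda>z. ?R `` {z}) ` topspace (prod_topology P X)"
    using UX unfolding V_def by auto
  ultimately show V: "openin ?X V"
    unfolding openin_quotient_map_iff [OF quot] sat by blast
  have "?S = {(z, w) \<in> ?R. snd z \<in> U}"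
    unfolding homotopy_orbit_rel_def topspace_subtopology by auto
  then have eq: "?S `` {z} = ?R `` {z}" if "snd z \<in> U" for z
    using that by blast
  have "quotient_map (subtopology (prod_topology P X) (topspace P \<times> U)) (subtopology ?X V) (\<lambda>z. ?R `` {z})"
    by (rule quotient_map_restriction [OF quot sat]) (simp add: V)
  moreover have "subtopology (prod_topology P X) (topspace P \<times> U) = prod_topology P (subtopology X U)"
    by (rule prod_topology_subtopology(2) [symmetric])
  ultimately have R: "quotient_map (prod_topology P (subtopology X U)) (subtopology ?X V) (\<lambda>z. ?R `` {z})"
    by simp
  have S: "quotient_map (prod_topology P (subtopology X U)) (homotopy_orbit_space P \<rho> (subtopology X U) \<alpha>) (\<lambda>z. ?R `` {z})"
  proof (rule quotient_map_eq [OF homotopy_orbit_quotient_map])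
    fix z assume "z \<in> topspace (prod_topology P (subtopology X U))"
    then show "?S `` {z} = ?R `` {z}"
      by (intro eq) auto
  qed
  show "homotopy_orbit_space P \<rho> (subtopology X U) \<alpha> = subtopology ?X V"
  proof (rule topology_eq [THEN iffD2], intro allI)
    fix W
    show "openin (homotopy_orbit_space P \<rho> (subtopology X U) \<alpha>) W \<longleftrightarrow> openin (subtopology ?X V) W"
      unfolding openin_quotient_map_iff [OF R] openin_quotient_map_iff [OF S] ..
  qed
qed

section \<open>Sectional category\<close>

text \<open>
  A cover can be enlarged by empty sets: on the empty space every function is an equivariant map,
  and all of them are equivariantly homotopic.
\<close>

lemma secat_cover_mono:
  assumes "secat_cover E \<epsilon> B \<beta> p k" "k \<le> l"
  shows "secat_cover E \<epsilon> B \<beta> p l"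
proof -
  let ?good = "\<lambda>U. openin B U \<and> (\<forall>g. \<forall>x\<in>U. \<beta> g x \<in> U) \<and>
    (\<exists>s. G_map (subtopology B U) \<beta> E \<epsilon> s \<and> G_homotopic (subtopology B U) \<beta> B \<beta> (p \<circ> s) (\<lambda>x. x))"
  obtain U where U: "(\<Union>i\<in>{1..k}. U i) = topspace B \<and> (\<forall>i\<in>{1..k}. ?good (U i))"
    using assms(1) unfolding secat_cover_def by (rule exE)
  have empty: "?good {}"
    by (simp add: G_map_def G_homotopic_def equivariant_on_def homotopic_on_empty)
  define W where "W i = (if i \<le> k then U i else {})" for i
  have "(\<Union>i\<in>{1..l}. W i) = (\<Union>i\<in>{1..k}. U i)"
    using assms(2) by (fastforce simp: W_def split: if_splits)
  moreover have "?good (W i)" if "i \<in> {1..l}" for i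
  proof (cases "i \<le> k")
    case True
    then have "W i = U i"
      by (simp add: W_def)
    moreover have "?good (U i)"
      using U True that by (meson atLeastAtMost_iff)
    ultimately show ?thesis
      by (rule ssubst)
  next
    case False
    then have "W i = {}"
      by (simp add: W_def)
    then show ?thesis
      using empty by (rule ssubst)
  qed
  ultimately have "(\<Union>i\<in>{1..l}. W i) = topspace B \<and> (\<forall>i\<in>{1..l}. ?good (W i))"
    using conjunct1 [OF U] by (simp only: simp_thms ball_simps) blast
  then show ?thesis
    unfolding secat_cover_def by (intro exI [of _ W])
qed

lemma secat_le_imp_cover:
  assumes "secat E \<epsilon> B \<beta> p \<le> enat k"
  shows "secat_cover E \<epsilon> B \<beta> p k"
proof -
  let ?K = "{enat k |k. 1 \<le> k \<and> secat_cover E \<epsilon> B \<beta> p k}"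
  have "?K \<noteq> {}"
  proof
    assume "?K = {}"
    then have "secat E \<epsilon> B \<beta> p = \<infinity>"
      unfolding secat_def by (simp only: Inf_enat_def if_True simp_thms)
    with assms show False
      by simp
  qed
  then have "secat E \<epsilon> B \<beta> p = (LEAST x. x \<in> ?K)"
    unfolding secat_def by (simp only: Inf_enat_def if_False)
  moreover obtain x where "x \<in> ?K"
    using \<open>?K \<noteq> {}\<close> by blast
  ultimately have "secat E \<epsilon> B \<beta> p \<in> ?K"
    using LeastI [of "\<lambda>x. x \<in> ?K"] by simp
  then show ?thesis
    using assms secat_cover_mono by auto
qed

theorem theorem2p7:
  fixes EG :: "'p topology" and BG :: "'q topology"
    and \<rho> :: "'p \<Rightarrow> 'g::{topological_group_add, t2_space} \<Rightarrow> 'p" and \<pi> :: "'p \<Rightarrow> 'q"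
    and E :: "'e topology" and \<epsilon> :: "'g \<Rightarrow> 'e \<Rightarrow> 'e"
    and B :: "'b topology" and \<beta> :: "'g \<Rightarrow> 'b \<Rightarrow> 'b"
    and p :: "'e \<Rightarrow> 'b" and k :: nat
    and b\<^sub>0 :: "('p \<times> 'b) set"
    and u :: "nat \<Rightarrow> (('p \<times> 'b) set, 'r::comm_ring_1) cochain set"
  assumes "universal_principal_bundle EG \<rho> BG \<pi>" "Hausdorff_space EG" "Hausdorff_space BG"
    and "left_G_space E \<epsilon>" "Hausdorff_space E"
    and "left_G_space B \<beta>" "Hausdorff_space B"
    and "G_map E \<epsilon> B \<beta> p"
    and "1 \<le> k"
    and "b\<^sub>0 \<in> topspace (homotopy_orbit_space EG \<rho> B \<beta>)"
    and "\<And>i. i \<in> {1..k} \<Longrightarrow> u i \<in> reduced_cohomology (homotopy_orbit_space EG \<rho> B \<beta>) b\<^sub>0"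
    and "\<And>i. i \<in> {1..k} \<Longrightarrow>
           induced (homotopy_orbit_space EG \<rho> E \<epsilon>) (homotopy_orbit_map p) (u i) =
             coh_zero (homotopy_orbit_space EG \<rho> E \<epsilon>)"
    and "cup_prod (homotopy_orbit_space EG \<rho> B \<beta>) u k \<noteq>
           coh_zero (homotopy_orbit_space EG \<rho> B \<beta>)"
  shows "secat E \<epsilon> B \<beta> p > enat k"
proof (rule ccontr)
  let ?E = "homotopy_orbit_space EG \<rho> E \<epsilon>" and ?B = "homotopy_orbit_space EG \<rho> B \<beta>"
  let ?q = "\<lambda>z. homotopy_orbit_rel EG \<rho> B \<beta> `` {z}"
  have EG: "right_G_space EG \<rho>"
    using assms(1) by (simp add: universal_principal_bundle_def principal_bundle_def)
  assume "\<not> enat k < secat E \<epsilon> B \<beta> p"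
  then have "secat_cover E \<epsilon> B \<beta> p k"
    by (intro secat_le_imp_cover) simp
  then obtain U where *: "(\<Union>i\<in>{1..k}. U i) = topspace B \<and> (\<forall>i\<in>{1..k}.
      openin B (U i) \<and> (\<forall>g. \<forall>x\<in>U i. \<beta> g x \<in> U i) \<and>
      (\<exists>s. G_map (subtopology B (U i)) \<beta> E \<epsilon> s \<and>
        G_homotopic (subtopology B (U i)) \<beta> B \<beta> (p \<circ> s) (\<lambda>x. x)))"
    unfolding secat_cover_def by (rule exE)
  then have cover: "(\<Union>i\<in>{1..k}. U i) = topspace B"
    by (rule conjunct1)
  have U: "openin B (U i)" "\<And>g x. x \<in> U i \<Longrightarrow> \<beta> g x \<in> U i"
      "\<exists>s. G_map (subtopology B (U i)) \<beta> E \<epsilon> s \<and>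
        G_homotopic (subtopology B (U i)) \<beta> B \<beta> (p \<circ> s) (\<lambda>x. x)" if "i \<in> {1..k}" for i
    using bspec [OF conjunct2 [OF *] that] by blast+
  define V where "V i = ?q ` (topspace EG \<times> U i)" for i
  have "cup_prod ?B u k = coh_zero ?B"
  proof (rule cup_prod_eq_zero_of_open_cover)
    show "openin ?B (V i)" if "i \<in> {1..k}" for i
      unfolding V_def using U(1,2) [OF that] by (intro homotopy_orbit_space_open_subset(1) EG assms(6))
    have "(\<Union>i\<in>{1..k}. V i) = ?q ` (topspace EG \<times> topspace B)"
      unfolding V_def cover [symmetric] by blast
    then show "(\<Union>i\<in>{1..k}. V i) = topspace ?B"
      using quotient_imp_surjective_map [OF homotopy_orbit_quotient_map [of EG B \<rho> \<beta>]] by simp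
    show coh: "u i \<in> cohomology ?B" if "i \<in> {1..k}" for i
      using assms(11) [OF that] by (simp add: reduced_cohomology_def)
    show "induced (subtopology ?B (V i)) (\<lambda>x. x) (u i) = coh_zero (subtopology ?B (V i))"
      if i: "i \<in> {1..k}" for i
    proof -
      let ?U = "subtopology B (U i)"
      have GU: "left_G_space ?U \<beta>"
        using U(2) [OF i] by (intro left_G_space_subtopology assms(6))
      have V: "homotopy_orbit_space EG \<rho> ?U \<beta> = subtopology ?B (V i)"
        unfolding V_def using U(1,2) [OF i] by (intro homotopy_orbit_space_open_subset(2) EG assms(6))
      obtain s where s: "G_map ?U \<beta> E \<epsilon> s" "G_homotopic ?U \<beta> B \<beta> (p \<circ> s) (\<lambda>x. x)"
        using U(3) [OF i] by blast
      obtain c where c: "c \<in> cocycles ?B" "u i = cohomologous ?B `` {c}"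
        using coh [OF i] by (rule cohomology_representative)
      have ps: "continuous_map ?E ?B (homotopy_orbit_map p)"
        "continuous_map (subtopology ?B (V i)) ?E (homotopy_orbit_map s)"
        using continuous_homotopy_orbit_map [OF EG assms(4,6,8)]
          continuous_homotopy_orbit_map [OF EG GU assms(4) s(1)] by (simp_all add: V)
      have "(pullback_cochain ?E (homotopy_orbit_map p) c, \<lambda>n \<sigma>. 0) \<in> cohomologous ?E"
        using assms(12) [OF i] c induced_class_eq_zero_iff [OF ps(1) c(1)] by simp
      then have "(pullback_cochain (subtopology ?B (V i)) (homotopy_orbit_map (p \<circ> s)) c, \<lambda>n \<sigma>. 0)
          \<in> cohomologous (subtopology ?B (V i))"
        unfolding homotopy_orbit_map_compose pullback_pullback [OF ps(2), symmetric]
        by (rule cohomologous_pullback_zero [OF ps(2)])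
      moreover have "(pullback_cochain (subtopology ?B (V i)) (\<lambda>x. x) c,
          pullback_cochain (subtopology ?B (V i)) (homotopy_orbit_map (p \<circ> s)) c) \<in> cohomologous (subtopology ?B (V i))"
        using homotopic_imp_cohomologous_pullback [OF homotopic_homotopy_orbit_map [OF EG GU assms(6) s(2)] c(1)]
        by (simp add: V homotopy_orbit_map_ident)
      ultimately have "(pullback_cochain (subtopology ?B (V i)) (\<lambda>x. x) c, \<lambda>n \<sigma>. 0) \<in> cohomologous (subtopology ?B (V i))"
        by (blast intro: cohomologous_trans)
      then show ?thesis
        unfolding c(2) by (subst induced_class_eq_zero_iff [OF _ c(1)]) (simp_all add: continuous_map_from_subtopology)
    qed
  qed
  with assms(13) show False ..
qed

end
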